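(* Assume $\Bbbk$ is uncountable. Every holonomic $A\mathcal{V}$-module $M$ is differentiable: the representation $\rho:\mathcal{V}\to\mathfrak{gl}(M)$ lies in $\mathrm{Diff}_s(\mathcal{V},\mathrm{End}_\Bbbk(M))$ for some $s\ge0$.
   Context: Setup: $\Bbbk$ algebraically closed, characteristic $0$; $A=\Bbbk[x_1,\dots,x_n]$; $\mathcal{V}=\mathrm{Der}(A)$. An $A\mathcal{V}$-module is an $A$-module and $\mathcal{V}$-module $M$ with $\eta(fm)=\eta(f)m+f(\eta m)$, i.e. a module over the smash product $A\#U(\mathcal{V})$; $\rho$ denotes the action map of $\mathcal{V}$. A finitely generated $A\mathcal{V}$-module is holonomic if it is $0$ or has Gelfand–Kirillov dimension $n$ over $A\#U(\mathcal{V})$ (GK dimension: $\limsup_m\log_m\dim(C^mM_0)$ for finite-dimensional generating subspaces $C\ni1$ of the algebra and $M_0$ of the module). Differential operators: for a commutative $\Bbbk$-algebra $R$ and $R$-modules $M',N'$, $\delta(f)D=D\circ f-f\circ D$ on $\mathrm{Hom}_\Bbbk(M',N')$; $\mathrm{Diff}_{-1}=0$, $\mathrm{Diff}_{s+1}(M',N')=\{D:\delta(f)D\in\mathrm{Diff}_s(M',N')\ \forall f\in R\}$. Here $R=A$, $\mathcal{V}$ is an $A$-module via $(f\eta)(g)=f\eta(g)$, and $\mathrm{End}_\Bbbk(M)$ is an $A$-module via $f\cdot T=f\circ T$, so $(\delta(f)\rho)(\eta)=\rho(f\eta)-f\circ\rho(\eta)$. *)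

theory Defs
  imports Complex_Main "HOL-Library.Poly_Mapping" "HOL-Library.Extended_Real"
    "HOL-Library.Liminf_Limsup" "HOL-Library.Countable_Set"
    "HOL-Computational_Algebra.Polynomial"
begin

text \<open>Multivariate polynomials: finitely supported functions from monomials
  (finitely supported exponent vectors 'v =>0 nat) to coefficients.  The variables
  are indexed by a finite type 'v, so n = CARD('v).\<close>

type_synonym ('v, 'k) mpoly = "('v \<Rightarrow>\<^sub>0 nat) \<Rightarrow>\<^sub>0 'k"

definition const :: "'k::zero \<Rightarrow> ('v, 'k) mpoly" where
  "const c = Poly_Mapping.single 0 c"

definition alg_closed :: "'k::field itself \<Rightarrow> bool" where
  "alg_closed _ \<longleftrightarrow> (\<forall>p::'k poly. degree p > 0 \<longrightarrow> (\<exists>x. poly p x = 0))"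

definition Der :: "(('v, 'k::comm_ring_1) mpoly \<Rightarrow> ('v, 'k) mpoly) set" where
  "Der = {D. (\<forall>f g. D (f + g) = D f + D g)
           \<and> (\<forall>c f. D (const c * f) = const c * D f)
           \<and> (\<forall>f g. D (f * g) = f * D g + g * D f)}"

definition Amul_V :: "('v, 'k::comm_ring_1) mpoly \<Rightarrow> (('v,'k) mpoly \<Rightarrow> ('v,'k) mpoly)
    \<Rightarrow> (('v,'k) mpoly \<Rightarrow> ('v,'k) mpoly)" where
  "Amul_V f \<eta> = (\<lambda>g. f * \<eta> g)"

definition bracket :: "(('v, 'k::comm_ring_1) mpoly \<Rightarrow> ('v,'k) mpoly)
    \<Rightarrow> (('v,'k) mpoly \<Rightarrow> ('v,'k) mpoly) \<Rightarrow> (('v,'k) mpoly \<Rightarrow> ('v,'k) mpoly)" where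
  "bracket \<eta> \<xi> = (\<lambda>g. \<eta> (\<xi> g) - \<xi> (\<eta> g))"

definition smul :: "(('v, 'k::comm_ring_1) mpoly \<Rightarrow> 'm \<Rightarrow> 'm) \<Rightarrow> 'k \<Rightarrow> 'm \<Rightarrow> 'm" where
  "smul actA c x = actA (const c) x"

definition AV_module :: "(('v, 'k::comm_ring_1) mpoly \<Rightarrow> 'm::ab_group_add \<Rightarrow> 'm)
    \<Rightarrow> ((('v,'k) mpoly \<Rightarrow> ('v,'k) mpoly) \<Rightarrow> 'm \<Rightarrow> 'm) \<Rightarrow> bool" where
  "AV_module actA actV \<longleftrightarrow>
     \<comment> \<open>A-module\<close>
     (\<forall>f x y. actA f (x + y) = actA f x + actA f y)
   \<and> (\<forall>f g x. actA (f + g) x = actA f x + actA g x)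
   \<and> (\<forall>f g x. actA (f * g) x = actA f (actA g x))
   \<and> (\<forall>x. actA 1 x = x)
     \<comment> \<open>V-module: rho : V -> gl(M) is a k-linear Lie algebra homomorphism\<close>
   \<and> (\<forall>\<eta>\<in>Der. \<forall>x y. actV \<eta> (x + y) = actV \<eta> x + actV \<eta> y)
   \<and> (\<forall>\<eta>\<in>Der. \<forall>c x. actV \<eta> (smul actA c x) = smul actA c (actV \<eta> x))
   \<and> (\<forall>\<eta>\<in>Der. \<forall>\<xi>\<in>Der. \<forall>x. actV (\<lambda>g. \<eta> g + \<xi> g) x = actV \<eta> x + actV \<xi> x)
   \<and> (\<forall>\<eta>\<in>Der. \<forall>c x. actV (\<lambda>g. const c * \<eta> g) x = smul actA c (actV \<eta> x))
   \<and> (\<forall>\<eta>\<in>Der. \<forall>\<xi>\<in>Der. \<forall>x.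
        actV (bracket \<eta> \<xi>) x = actV \<eta> (actV \<xi> x) - actV \<xi> (actV \<eta> x))
     \<comment> \<open>compatibility: eta(f m) = eta(f) m + f (eta m)\<close>
   \<and> (\<forall>\<eta>\<in>Der. \<forall>f x. actV \<eta> (actA f x) = actA (\<eta> f) x + actA f (actV \<eta> x))"

inductive_set mspan :: "(('v, 'k::comm_ring_1) mpoly \<Rightarrow> 'm::ab_group_add \<Rightarrow> 'm) \<Rightarrow> 'm set \<Rightarrow> 'm set"
  for actA S where
  zero: "0 \<in> mspan actA S"
| base: "x \<in> S \<Longrightarrow> x \<in> mspan actA S"
| add: "x \<in> mspan actA S \<Longrightarrow> y \<in> mspan actA S \<Longrightarrow> x + y \<in> mspan actA S"
| scal: "x \<in> mspan actA S \<Longrightarrow> smul actA c x \<in> mspan actA S"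

inductive_set opspan :: "(('v, 'k::comm_ring_1) mpoly \<Rightarrow> 'm::ab_group_add \<Rightarrow> 'm)
    \<Rightarrow> ('m \<Rightarrow> 'm) set \<Rightarrow> ('m \<Rightarrow> 'm) set"
  for actA S where
  zero: "(\<lambda>x. 0) \<in> opspan actA S"
| base: "T \<in> S \<Longrightarrow> T \<in> opspan actA S"
| add: "T \<in> opspan actA S \<Longrightarrow> U \<in> opspan actA S \<Longrightarrow> (\<lambda>x. T x + U x) \<in> opspan actA S"
| scal: "T \<in> opspan actA S \<Longrightarrow> (\<lambda>x. smul actA c (T x)) \<in> opspan actA S"

inductive_set subalg :: "(('v, 'k::comm_ring_1) mpoly \<Rightarrow> 'm::ab_group_add \<Rightarrow> 'm)
    \<Rightarrow> ('m \<Rightarrow> 'm) set \<Rightarrow> ('m \<Rightarrow> 'm) set"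
  for actA S where
  one: "id \<in> subalg actA S"
| base: "T \<in> S \<Longrightarrow> T \<in> subalg actA S"
| add: "T \<in> subalg actA S \<Longrightarrow> U \<in> subalg actA S \<Longrightarrow> (\<lambda>x. T x + U x) \<in> subalg actA S"
| scal: "T \<in> subalg actA S \<Longrightarrow> (\<lambda>x. smul actA c (T x)) \<in> subalg actA S"
| comp: "T \<in> subalg actA S \<Longrightarrow> U \<in> subalg actA S \<Longrightarrow> T \<circ> U \<in> subalg actA S"

text \<open>Image of A # U(V) in End_k(M): generated by the actions of A and of V.\<close>
definition act_alg :: "(('v, 'k::comm_ring_1) mpoly \<Rightarrow> 'm::ab_group_add \<Rightarrow> 'm)
    \<Rightarrow> ((('v,'k) mpoly \<Rightarrow> ('v,'k) mpoly) \<Rightarrow> 'm \<Rightarrow> 'm) \<Rightarrow> ('m \<Rightarrow> 'm) set" where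
  "act_alg actA actV = subalg actA (range actA \<union> actV ` Der)"

definition vdim :: "(('v, 'k::comm_ring_1) mpoly \<Rightarrow> 'm::ab_group_add \<Rightarrow> 'm) \<Rightarrow> 'm set \<Rightarrow> nat" where
  "vdim actA W = (LEAST d. \<exists>F. finite F \<and> F \<subseteq> W \<and> card F = d \<and> mspan actA F = W)"

definition fd_subspace :: "(('v, 'k::comm_ring_1) mpoly \<Rightarrow> 'm::ab_group_add \<Rightarrow> 'm) \<Rightarrow> 'm set \<Rightarrow> bool" where
  "fd_subspace actA W \<longleftrightarrow> (\<exists>F. finite F \<and> mspan actA F = W)"

definition fd_opsubspace :: "(('v, 'k::comm_ring_1) mpoly \<Rightarrow> 'm::ab_group_add \<Rightarrow> 'm)
    \<Rightarrow> ('m \<Rightarrow> 'm) set \<Rightarrow> bool" where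
  "fd_opsubspace actA C \<longleftrightarrow> (\<exists>F. finite F \<and> opspan actA F = C)"

fun comps :: "('m \<Rightarrow> 'm) set \<Rightarrow> nat \<Rightarrow> ('m \<Rightarrow> 'm) set" where
  "comps C 0 = {id}"
| "comps C (Suc m) = {S \<circ> T | S T. S \<in> C \<and> T \<in> comps C m}"

definition powmod :: "(('v, 'k::comm_ring_1) mpoly \<Rightarrow> 'm::ab_group_add \<Rightarrow> 'm)
    \<Rightarrow> ('m \<Rightarrow> 'm) set \<Rightarrow> nat \<Rightarrow> 'm set \<Rightarrow> 'm set" where
  "powmod actA C m M0 = mspan actA {T x | T x. T \<in> comps C m \<and> x \<in> M0}"

definition gen_alg_subspace :: "(('v, 'k::comm_ring_1) mpoly \<Rightarrow> 'm::ab_group_add \<Rightarrow> 'm)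
    \<Rightarrow> ((('v,'k) mpoly \<Rightarrow> ('v,'k) mpoly) \<Rightarrow> 'm \<Rightarrow> 'm) \<Rightarrow> ('m \<Rightarrow> 'm) set \<Rightarrow> bool" where
  "gen_alg_subspace actA actV C \<longleftrightarrow>
     fd_opsubspace actA C \<and> id \<in> C \<and> C \<subseteq> act_alg actA actV
     \<and> subalg actA C = act_alg actA actV"

definition gen_mod_subspace :: "(('v, 'k::comm_ring_1) mpoly \<Rightarrow> 'm::ab_group_add \<Rightarrow> 'm)
    \<Rightarrow> ((('v,'k) mpoly \<Rightarrow> ('v,'k) mpoly) \<Rightarrow> 'm \<Rightarrow> 'm) \<Rightarrow> 'm set \<Rightarrow> bool" where
  "gen_mod_subspace actA actV M0 \<longleftrightarrow>
     fd_subspace actA M0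
     \<and> mspan actA {T x | T x. T \<in> act_alg actA actV \<and> x \<in> M0} = UNIV"

definition fin_gen :: "(('v, 'k::comm_ring_1) mpoly \<Rightarrow> 'm::ab_group_add \<Rightarrow> 'm)
    \<Rightarrow> ((('v,'k) mpoly \<Rightarrow> ('v,'k) mpoly) \<Rightarrow> 'm \<Rightarrow> 'm) \<Rightarrow> bool" where
  "fin_gen actA actV \<longleftrightarrow> (\<exists>M0. gen_mod_subspace actA actV M0)"

definition GKdim :: "(('v, 'k::comm_ring_1) mpoly \<Rightarrow> 'm::ab_group_add \<Rightarrow> 'm)
    \<Rightarrow> ((('v,'k) mpoly \<Rightarrow> ('v,'k) mpoly) \<Rightarrow> 'm \<Rightarrow> 'm) \<Rightarrow> ereal" where
  "GKdim actA actV =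
     (SUP CM \<in> {(C, M0). gen_alg_subspace actA actV C \<and> gen_mod_subspace actA actV M0}.
        limsup (\<lambda>m. ereal (ln (real (vdim actA (powmod actA (fst CM) m (snd CM)))) / ln (real m))))"

definition holonomic :: "(('v::finite, 'k::comm_ring_1) mpoly \<Rightarrow> 'm::ab_group_add \<Rightarrow> 'm)
    \<Rightarrow> ((('v,'k) mpoly \<Rightarrow> ('v,'k) mpoly) \<Rightarrow> 'm \<Rightarrow> 'm) \<Rightarrow> bool" where
  "holonomic actA actV \<longleftrightarrow>
     fin_gen actA actV \<and> ((UNIV :: 'm set) = {0} \<or> GKdim actA actV = ereal (real (card (UNIV :: 'v set))))"

definition delta :: "(('v, 'k::comm_ring_1) mpoly \<Rightarrow> 'm::ab_group_add \<Rightarrow> 'm) \<Rightarrow> ('v,'k) mpoly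
    \<Rightarrow> ((('v,'k) mpoly \<Rightarrow> ('v,'k) mpoly) \<Rightarrow> 'm \<Rightarrow> 'm)
    \<Rightarrow> ((('v,'k) mpoly \<Rightarrow> ('v,'k) mpoly) \<Rightarrow> 'm \<Rightarrow> 'm)" where
  "delta actA f D = (\<lambda>\<eta> x. D (Amul_V f \<eta>) x - actA f (D \<eta> x))"

definition Hom_V_End :: "(('v, 'k::comm_ring_1) mpoly \<Rightarrow> 'm::ab_group_add \<Rightarrow> 'm)
    \<Rightarrow> ((('v,'k) mpoly \<Rightarrow> ('v,'k) mpoly) \<Rightarrow> 'm \<Rightarrow> 'm) \<Rightarrow> bool" where
  "Hom_V_End actA D \<longleftrightarrow>
     (\<forall>\<eta>\<in>Der. \<forall>x y. D \<eta> (x + y) = D \<eta> x + D \<eta> y)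
   \<and> (\<forall>\<eta>\<in>Der. \<forall>c x. D \<eta> (smul actA c x) = smul actA c (D \<eta> x))
   \<and> (\<forall>\<eta>\<in>Der. \<forall>\<xi>\<in>Der. \<forall>x. D (\<lambda>g. \<eta> g + \<xi> g) x = D \<eta> x + D \<xi> x)
   \<and> (\<forall>\<eta>\<in>Der. \<forall>c x. D (\<lambda>g. const c * \<eta> g) x = smul actA c (D \<eta> x))"

text \<open>Diff s here is Diff_s for s >= 0; Diff_{-1} = 0 is built into the base case.\<close>
fun Diff :: "(('v, 'k::comm_ring_1) mpoly \<Rightarrow> 'm::ab_group_add \<Rightarrow> 'm) \<Rightarrow> nat
    \<Rightarrow> ((('v,'k) mpoly \<Rightarrow> ('v,'k) mpoly) \<Rightarrow> 'm \<Rightarrow> 'm) set" where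
  "Diff actA 0 = {D. Hom_V_End actA D \<and> (\<forall>f. \<forall>\<eta>\<in>Der. \<forall>x. delta actA f D \<eta> x = 0)}"
| "Diff actA (Suc s) = {D. Hom_V_End actA D \<and> (\<forall>f. delta actA f D \<in> Diff actA s)}"

end

theory Submission
  imports Defs "HOL-Library.Cardinality"
begin

text \<open>
  Put \<open>t_a = (\<delta>(x_j)^a \<rho>)(\<partial>_j)\<close>. For \<open>a \<ge> 1\<close> these operators commute with the Weyl algebra \<open>D\<close> generated by
  \<open>A\<close> and the \<open>\<rho>(\<partial>_i)\<close>, and \<open>[t_1, t_a] = (a - 1) t_a\<close>.

  Bernstein's inequality holds uniformly: for a \<open>D\<close>-submodule \<open>N\<close> and \<open>v \<notin> N\<close>, the span of the
  monomials in \<open>x, \<partial>\<close> of box degree \<open>m\<close> applied to \<open>v\<close> grows at least like \<open>m^n\<close> modulo \<open>N\<close>.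
  Hence, in a filtration by \<open>D\<close>-submodules generated by finite-dimensional pieces, infinitely many
  strict steps would produce growth \<open>m^(n+1)\<close>, so a holonomic module is finitely generated over
  \<open>D\<close>. If \<open>v\<close> is not annihilated by any nonzero polynomial in \<open>t_1\<close>, the same count over
  \<open>D[t_1]\<close> gives growth at least \<open>m^(n+1/2)\<close>; so \<open>t_1\<close> is algebraic on \<open>M\<close>. As \<open>t_a\<close> shifts the
  eigenvalues of \<open>t_1\<close> by \<open>a - 1\<close>, it vanishes for large \<open>a\<close>. Finally
  \<open>[t_a, (\<delta>(x_j)^b \<rho>)(\<zeta>)] = 0\<close> for large \<open>a\<close> forces \<open>\<delta>(x_j)^c \<rho> = 0\<close> for large \<open>c\<close>, for every \<open>j\<close>.
\<close>

section \<open>Weyl pairs and the Bernstein inequality\<close>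

text \<open>Gaussian elimination: an unknown \<open>p\<close> with nonzero coefficient in equation
  \<open>j\<close> is solved for and substituted into the other equations, leaving one unknown and
  one equation fewer.\<close>

lemma homogeneous_system_nontrivial:
  fixes a :: "'i \<Rightarrow> 'j \<Rightarrow> 'k::field"
  assumes "finite J" "finite I" "card J < card I"
  shows "\<exists>c. (\<exists>i\<in>I. c i \<noteq> 0) \<and> (\<forall>j\<in>J. (\<Sum>i\<in>I. c i * a i j) = 0)"
  using assms
proof (induction J arbitrary: I a rule: finite_induct)
  case empty
  then have "I \<noteq> {}" by auto
  then show ?case by (intro exI[of _ "\<lambda>_. 1"]) auto
next
  case (insert j J)
  show ?case
  proof (cases "\<forall>i\<in>I. a i j = 0")
    case True
    from insert.IH[of I a] insert.prems insert.hyps obtain c where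
      "\<exists>i\<in>I. c i \<noteq> 0" "\<forall>j\<in>J. (\<Sum>i\<in>I. c i * a i j) = 0" by auto
    with True show ?thesis by (intro exI[of _ c]) auto
  next
    case False
    then obtain p where p: "p \<in> I" "a p j \<noteq> 0" by auto
    define I' where "I' = I - {p}"
    have I': "finite I'" "card J < card I'" "p \<notin> I'" "I = insert p I'"
      using insert p by (auto simp: I'_def card_Diff_singleton)
    from insert.IH[of I' "\<lambda>i l. a i l - a i j / a p j * a p l"] I' obtain c where
      c: "\<exists>i\<in>I'. c i \<noteq> 0"
        "\<And>l. l \<in> J \<Longrightarrow> (\<Sum>i\<in>I'. c i * (a i l - a i j / a p j * a p l)) = 0" by auto
    \<comment> \<open>The value at \<open>p\<close> is the one forced by equation \<open>j\<close>;
      with it, every equation for \<open>d\<close> on \<open>I\<close> becomes the reduced equation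
      for \<open>c\<close> on \<open>I'\<close>.\<close>
    define d where "d = c(p := - (\<Sum>i\<in>I'. c i * a i j) / a p j)"
    have d: "(\<Sum>i\<in>I'. d i * a i l) = (\<Sum>i\<in>I'. c i * a i l)" for l
      using I' by (intro sum.cong) (auto simp: d_def)
    have "(\<Sum>i\<in>I. d i * a i l) = (\<Sum>i\<in>I'. c i * (a i l - a i j / a p j * a p l))" for l
      using I' by (simp add: d) (simp add: d_def sum_subtractf algebra_simps sum_distrib_left
          sum_distrib_right sum_divide_distrib)
    moreover have "(\<Sum>i\<in>I'. c i * (a i j - a i j / a p j * a p j)) = 0" using p by simp
    ultimately have "\<forall>l\<in>insert j J. (\<Sum>i\<in>I. d i * a i l) = 0" using c by auto
    moreover have "\<exists>i\<in>I. d i \<noteq> 0" using c(1) I' by (auto simp: d_def)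
    ultimately show ?thesis by blast
  qed
qed

section \<open>Linear operators over a field of characteristic zero\<close>

locale char0_space = vector_space scale
  for scale :: "'k::field_char_0 \<Rightarrow> 'b::ab_group_add \<Rightarrow> 'b" (infixr \<open>*s\<close> 75)
begin

definition lin :: "('b \<Rightarrow> 'b) \<Rightarrow> bool" where
  "lin T \<longleftrightarrow> (\<forall>x y. T (x + y) = T x + T y) \<and> (\<forall>c x. T (c *s x) = c *s T x)"

lemma lin_add: "lin T \<Longrightarrow> T (x + y) = T x + T y"
  and lin_scale: "lin T \<Longrightarrow> T (c *s x) = c *s T x"
  by (auto simp: lin_def)

lemma lin_0: "lin T \<Longrightarrow> T 0 = 0"
  using lin_scale[of T 0 0] by simp

lemma lin_neg: "lin T \<Longrightarrow> T (- x) = - T x"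
  using lin_scale[of T "-1" x] by simp

lemma lin_diff: "lin T \<Longrightarrow> T (x - y) = T x - T y"
  using lin_add[of T x "- y"] by (simp add: lin_neg)

lemma lin_sum: "lin T \<Longrightarrow> T (\<Sum>i\<in>I. f i) = (\<Sum>i\<in>I. T (f i))"
  by (induction I rule: infinite_finite_induct) (auto simp: lin_0 lin_add)

lemma lin_comp: "lin T \<Longrightarrow> lin U \<Longrightarrow> lin (\<lambda>x. T (U x))"
  by (simp add: lin_def)

lemma lin_funpow: "lin T \<Longrightarrow> lin (T ^^ n)"
  by (induction n) (auto simp: lin_def)

lemma lin_span: "lin T \<Longrightarrow> T ` S \<subseteq> W \<Longrightarrow> subspace W \<Longrightarrow> x \<in> span S \<Longrightarrow> T x \<in> W"
  by (rule span_induct_alt[of x S "\<lambda>x. T x \<in> W"])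
    (auto simp: lin_0 lin_add lin_scale subspace_0 subspace_add subspace_scale)

lemma funpow_commute: "(\<And>x. T (U x) = U (T x)) \<Longrightarrow> (T ^^ n) ((U ^^ m) x) = (U ^^ m) ((T ^^ n) x)"
proof (induction n)
  case (Suc n)
  have "T ((U ^^ m) y) = (U ^^ m) (T y)" for y by (induction m) (auto simp: Suc.prems)
  then show ?case using Suc by simp
qed simp

lemma funpow_in: "(\<And>x. x \<in> N \<Longrightarrow> T x \<in> N) \<Longrightarrow> x \<in> N \<Longrightarrow> (T ^^ n) x \<in> N"
  by (induction n) auto

text \<open>Applying \<open>Q\<close> to the equation for \<open>d\<close> and subtracting the equation for \<open>Suc d\<close> lowers the
  degree in \<open>P\<close>.\<close>

lemma weyl_separation:
  assumes P: "lin P" "\<And>x. x \<in> N \<Longrightarrow> P x \<in> N" and Q: "lin Q" "\<And>x. x \<in> N \<Longrightarrow> Q x \<in> N"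
    and N: "subspace N" and PQ: "\<And>x. Q (P x) = P (Q x) + c *s x" and c: "c \<noteq> 0"
    and "\<And>d. d < m \<Longrightarrow> (\<Sum>a<m. (P ^^ a) ((Q ^^ d) (u a))) \<in> N"
    and "a < m"
  shows "u a \<in> N"
  using assms(8-)
proof (induction m arbitrary: u a)
  case (Suc m)
  \<comment> \<open>This is \<open>[Q, P^a] = a c P^(a-1)\<close>. At \<open>a = 0\<close> the
    truncated exponent does no harm, as its coefficient is zero.\<close>
  have comm: "Q ((P ^^ a) x) = (P ^^ a) (Q x) + (of_nat a * c) *s (P ^^ (a - 1)) x" for a x
  proof (induction a)
    case (Suc a)
    have "P ((of_nat a * c) *s (P ^^ (a - 1)) x) = (of_nat a * c) *s (P ^^ a) x"
      by (cases a) (simp_all add: lin_scale[OF P(1)] lin_0[OF P(1)])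
    then show ?case
      by (simp add: Suc PQ lin_add[OF P(1)] distrib_right scale_left_distrib add_ac)
  qed simp
  \<comment> \<open>The coefficients of the formal derivative in \<open>P\<close>, up to the factor
    \<open>c\<close>. Characteristic zero allows \<open>u (Suc a)\<close> to be recovered from
    them.\<close>
  define u' where "u' a = (of_nat (Suc a) * c) *s u (Suc a)" for a
  have P': "lin (P ^^ a)" and Q': "lin (Q ^^ a)" for a
    using P Q by (auto intro: lin_funpow)
  have "(\<Sum>a<m. (P ^^ a) ((Q ^^ d) (u' a))) \<in> N" if d: "d < m" for d
  proof -
    have "Q (\<Sum>a<Suc m. (P ^^ a) ((Q ^^ d) (u a))) - (\<Sum>a<Suc m. (P ^^ a) ((Q ^^ Suc d) (u a))) \<in> N"
      using d by (intro subspace_diff[OF N] Q(2) Suc.prems(1)) auto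
    also have "Q (\<Sum>a<Suc m. (P ^^ a) ((Q ^^ d) (u a))) - (\<Sum>a<Suc m. (P ^^ a) ((Q ^^ Suc d) (u a)))
       = (\<Sum>a<Suc m. Q ((P ^^ a) ((Q ^^ d) (u a))) - (P ^^ a) ((Q ^^ Suc d) (u a)))"
      by (simp only: lin_sum[OF Q(1)] sum_subtractf)
    also have "\<dots> = (\<Sum>a<Suc m. (of_nat a * c) *s (P ^^ (a - 1)) ((Q ^^ d) (u a)))"
      by (rule sum.cong) (simp_all add: comm)
    also have "\<dots> = (\<Sum>a<m. (P ^^ a) ((Q ^^ d) (u' a)))"
      unfolding sum.lessThan_Suc_shift
      by (simp add: u'_def lin_scale[OF P'] lin_scale[OF Q'])
    finally show ?thesis .
  qed
  from Suc.IH[OF this] have u': "u' a \<in> N" if "a < m" for a using that by blast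
  have Su: "u (Suc a) \<in> N" if "a < m" for a
  proof -
    have nz: "of_nat (Suc a) * c \<noteq> 0" using c by (simp del: of_nat_Suc)
    have "u (Suc a) = inverse (of_nat (Suc a) * c) *s u' a"
      by (simp only: u'_def scale_scale field_class.field_inverse[OF nz] scale_one)
    then show ?thesis using u'[OF that] subspace_scale[OF N] by simp
  qed
  have "(\<Sum>a<Suc m. (P ^^ a) (u a)) \<in> N" using Suc.prems(1)[of 0] by simp
  then have "u 0 + (\<Sum>a<m. (P ^^ Suc a) (u (Suc a))) \<in> N"
    unfolding sum.lessThan_Suc_shift by simp
  moreover have "(\<Sum>a<m. (P ^^ Suc a) (u (Suc a))) \<in> N"
    using Su P(2) by (intro subspace_sum[OF N] funpow_in) auto
  ultimately have "u 0 \<in> N" using subspace_diff[OF N] by fastforce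
  then show ?case using Su Suc.prems(2) by (cases a) auto
qed simp

section \<open>Monomials in several Weyl pairs\<close>

primrec word :: "('b \<Rightarrow> 'b) list \<Rightarrow> nat list \<Rightarrow> 'b \<Rightarrow> 'b" where
  "word [] as x = x"
| "word (P # Ps) as x = (P ^^ hd as) (word Ps (tl as) x)"

text \<open>Beyond the relation inside each pair, only the second member of a pair has to commute
  with the first members of later pairs. This admits both \<open>(x_j, d_j)\<close> and
  \<open>(d_j, x_j)\<close> in one list, although \<open>x_j\<close> and \<open>d_j\<close> do not
  commute.\<close>

primrec weyl_pairs :: "(('b \<Rightarrow> 'b) \<times> ('b \<Rightarrow> 'b)) list \<Rightarrow> bool" where
  "weyl_pairs [] = True"
| "weyl_pairs (PQ # PQs) = (weyl_pairs PQs \<and> lin (fst PQ) \<and> lin (snd PQ) \<and>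
     (\<exists>c. c \<noteq> 0 \<and> (\<forall>x. snd PQ (fst PQ x) = fst PQ (snd PQ x) + c *s x)) \<and>
     (\<forall>(P', Q') \<in> set PQs. \<forall>x. P' (snd PQ x) = snd PQ (P' x)))"

abbreviation box :: "nat \<Rightarrow> nat \<Rightarrow> nat list set" where
  "box l m \<equiv> {as. set as \<subseteq> {..<m} \<and> length as = l}"

lemma finite_box: "finite (box l m)" and card_box: "card (box l m) = m ^ l"
  by (auto simp: finite_lists_length_eq card_lists_length_eq)

lemma sum_box_Suc: "(\<Sum>as\<in>box (Suc l) m. f as) = (\<Sum>a<m. \<Sum>as\<in>box l m. f (a # as))"
proof -
  have "box (Suc l) m = (\<lambda>(a, as). a # as) ` ({..<m} \<times> box l m)"
    by (auto simp: image_iff length_Suc_conv)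
  moreover have "inj_on (\<lambda>(a, as). a # as) ({..<m} \<times> box l m)" by (auto simp: inj_on_def)
  ultimately show ?thesis by (simp add: sum.reindex sum.cartesian_product case_prod_unfold)
qed

lemma lin_word: "(\<And>P. P \<in> set Ps \<Longrightarrow> lin P) \<Longrightarrow> lin (word Ps as)"
proof (induction Ps arbitrary: as)
  case (Cons P Ps)
  have "lin (\<lambda>x. (P ^^ hd as) (word Ps (tl as) x))"
    by (rule lin_comp[OF lin_funpow]) (use Cons in auto)
  then show ?case by (simp add: lin_def)
qed (auto simp: lin_def)

lemma word_commute:
  "(\<And>P x. P \<in> set Ps \<Longrightarrow> P (T x) = T (P x)) \<Longrightarrow> word Ps as ((T ^^ n) x) = (T ^^ n) (word Ps as x)"
proof (induction Ps arbitrary: as)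
  case (Cons P Ps)
  then show ?case using funpow_commute[of P T "hd as" n] by simp
qed simp

lemma weyl_pairs_lin: "weyl_pairs PQs \<Longrightarrow> PQ \<in> set PQs \<Longrightarrow> lin (fst PQ) \<and> lin (snd PQ)"
  by (induction PQs) auto

text \<open>Induction on the list. Powers of the first \<open>Q\<close> move past words in the later
  \<open>P\<close>, so the sum takes the form treated by \<open>weyl_separation\<close>, with the
  sums over the remaining pairs as coefficients.\<close>

lemma weyl_separation_multi:
  assumes "weyl_pairs PQs" "subspace N"
    and "\<And>P Q x. (P, Q) \<in> set PQs \<Longrightarrow> x \<in> N \<Longrightarrow> P x \<in> N \<and> Q x \<in> N"
    and "\<And>ds. ds \<in> box (length PQs) m \<Longrightarrow>
      (\<Sum>as\<in>box (length PQs) m. word (map fst PQs) as (word (map snd PQs) ds (u as))) \<in> N"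
    and "as \<in> box (length PQs) m"
  shows "u as \<in> N"
  using assms
proof (induction PQs arbitrary: u as)
  case Nil
  have "box 0 m = {[]}" by auto
  with Nil show ?case by simp
next
  case (Cons PQ PQs)
  obtain P Q where PQ: "PQ = (P, Q)" by (cases PQ)
  from Cons.prems(1) obtain c where c: "c \<noteq> 0" "\<And>x. Q (P x) = P (Q x) + c *s x"
    by (auto simp: PQ)
  from Cons.prems(1) have l: "lin P" "lin Q" and W: "weyl_pairs PQs"
    and comm: "\<And>P' x. P' \<in> set (map fst PQs) \<Longrightarrow> P' (Q x) = Q (P' x)"
    by (auto simp: PQ)
  have stab: "P x \<in> N" "Q x \<in> N" if "x \<in> N" for x using Cons.prems(3) that by (auto simp: PQ)
  let ?p = "word (map fst PQs)" and ?q = "word (map snd PQs)" and ?B = "box (length PQs) m"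
  obtain a as' where as: "as = a # as'" "a < m" "as' \<in> ?B"
    using Cons.prems(5) by (cases as) auto
  have pQ: "?p as ((Q ^^ n) x) = (Q ^^ n) (?p as x)" for as n x
    by (rule word_commute) (rule comm)
  have "(\<Sum>as\<in>?B. ?p as (?q ds (u (a # as)))) \<in> N" if ds: "ds \<in> ?B" for ds
  proof -
    have "(\<Sum>a<m. (P ^^ a) ((Q ^^ d) (\<Sum>as\<in>?B. ?p as (?q ds (u (a # as)))))) \<in> N" if d: "d < m" for d
    proof -
      have "d # ds \<in> box (length (PQ # PQs)) m" using d ds by auto
      from Cons.prems(4)[OF this] show ?thesis
        by (simp add: PQ sum_box_Suc lin_sum[OF lin_funpow, OF l(1)] lin_sum[OF lin_funpow, OF l(2)]
          pQ)
    qed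
    from weyl_separation[OF l(1) stab(1) l(2) stab(2) Cons.prems(2) c(2,1) this as(2)]
    show ?thesis by blast
  qed
  then have "u (a # as') \<in> N"
    using Cons.IH[of "\<lambda>as. u (a # as)" as'] W Cons.prems(2,3) as(3) by auto
  then show ?case by (simp add: as)
qed

text \<open>A model of the quotient by \<open>N\<close> inside the space itself: a basis of
  \<open>N\<close> is extended to the whole space, and \<open>\<pi>\<close> kills the former and
  fixes the added vectors.\<close>

lemma projection_exists:
  assumes "subspace N"
  obtains \<pi> where "lin \<pi>" "\<And>x. \<pi> x = 0 \<longleftrightarrow> x \<in> N" "\<And>x. x - \<pi> x \<in> N"
proof -
  interpret pr: vector_space_pair scale scale by unfold_locales
  obtain B where B: "B \<subseteq> N" "independent B" "N \<subseteq> span B"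
    by (rule maximal_independent_subset)
  obtain B' where B': "B \<subseteq> B'" "independent B'" "UNIV \<subseteq> span B'"
    using maximal_independent_subset_extend[OF subset_UNIV B(2)] by metis
  obtain \<pi> where \<pi>: "Vector_Spaces.linear scale scale \<pi>" "\<forall>x\<in>B'. \<pi> x = (if x \<in> B then 0 else x)"
    using pr.linear_independent_extend[OF B'(2), of "\<lambda>x. if x \<in> B then 0 else x"] by blast
  have l: "lin \<pi>" using pr.linear_add[OF \<pi>(1)] pr.linear_scale[OF \<pi>(1)] by (simp add: lin_def)
  have "lin (\<lambda>x. x - \<pi> x)" using l by (simp add: lin_def algebra_simps)
  then have N: "x - \<pi> x \<in> N" for x
    by (rule lin_span[where S = B']) (use B B' \<pi>(2) assms in \<open>auto simp: subspace_0\<close>)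
  have K: "\<pi> x \<in> {0}" if "x \<in> N" for x
    by (rule lin_span[OF l, where S = B]) (use that B B' \<pi>(2) in \<open>auto simp: subspace_def\<close>)
  show ?thesis
  proof (rule that[OF l _ N])
    show "\<pi> x = 0 \<longleftrightarrow> x \<in> N" for x using N[of x] K[of x] by auto
  qed
qed

text \<open>Restricted to \<open>X\<close>, each \<open>\<psi> k\<close> is described by a matrix
  with \<open>card X * card Y\<close> entries. More operators than entries would give a nontrivial
  linear relation among them.\<close>

lemma independent_operators_bound:
  assumes K: "finite K" and X: "finite X" and Y: "finite Y"
    and XY: "\<And>k x. k \<in> K \<Longrightarrow> x \<in> X \<Longrightarrow> \<psi> k x \<in> span Y"
    and indep: "\<And>c. (\<forall>x\<in>X. (\<Sum>k\<in>K. c k *s \<psi> k x) = 0) \<Longrightarrow> \<forall>k\<in>K. c k = 0"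
  shows "card K \<le> card X * card Y"
proof (rule ccontr)
  assume "\<not> ?thesis"
  then have "card (X \<times> Y) < card K" by (simp add: card_cartesian_product)
  have "\<forall>k x. \<exists>r. k \<in> K \<longrightarrow> x \<in> X \<longrightarrow> \<psi> k x = (\<Sum>y\<in>Y. r y *s y)"
    using XY by (auto simp: span_finite[OF Y])
  then obtain r where r: "\<And>k x. k \<in> K \<Longrightarrow> x \<in> X \<Longrightarrow> \<psi> k x = (\<Sum>y\<in>Y. r k x y *s y)"
    by metis
  obtain c where c: "\<exists>k\<in>K. c k \<noteq> 0" "\<forall>(x, y)\<in>X \<times> Y. (\<Sum>k\<in>K. c k * r k x y) = 0"
    using homogeneous_system_nontrivial[OF finite_cartesian_product[OF X Y] K \<open>card (X \<times> Y) < card K\<close>,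
        of "\<lambda>k (x, y). r k x y"] by (auto simp: case_prod_unfold)
  have "(\<Sum>k\<in>K. c k *s \<psi> k x) = 0" if "x \<in> X" for x
  proof -
    have "(\<Sum>k\<in>K. c k *s \<psi> k x) = (\<Sum>k\<in>K. \<Sum>y\<in>Y. (c k * r k x y) *s y)"
      using that by (intro sum.cong) (auto simp: r scale_sum_right)
    also have "\<dots> = (\<Sum>y\<in>Y. (\<Sum>k\<in>K. c k * r k x y) *s y)"
      by (subst sum.swap) (simp add: scale_sum_left)
    also have "\<dots> = 0" using c(2) that by (intro sum.neutral) auto
    finally show ?thesis .
  qed
  with indep[of c] c(1) show False by auto
qed

text \<open>The monomials \<open>P^a E^i\<close> are linearly independent
  as maps from the vectors \<open>Q^d v\<close> to the quotient.\<close>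

lemma bernstein_bound:
  assumes W: "weyl_pairs PQs" and N: "subspace N"
    and stab: "\<And>P Q x. (P, Q) \<in> set PQs \<Longrightarrow> x \<in> N \<Longrightarrow> P x \<in> N \<and> Q x \<in> N"
    and E: "lin E" "\<And>x. x \<in> N \<Longrightarrow> E x \<in> N"
    and EQ: "\<And>P Q x. (P, Q) \<in> set PQs \<Longrightarrow> Q (E x) = E (Q x)"
    and v: "\<And>c. (\<Sum>i<L. c i *s (E ^^ i) v) \<in> N \<Longrightarrow> \<forall>i<L. c i = 0"
    and B: "finite B0" "finite B1" "B0 \<subseteq> B1" "B0 \<subseteq> N"
    and G1: "\<And>ds. ds \<in> box (length PQs) m \<Longrightarrow> word (map snd PQs) ds v \<in> span B1"
    and G2: "\<And>as ds i. as \<in> box (length PQs) m \<Longrightarrow> ds \<in> box (length PQs) m \<Longrightarrow> i < L \<Longrightarrow>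
      word (map fst PQs) as ((E ^^ i) (word (map snd PQs) ds v)) \<in> span B1"
  shows "m ^ length PQs * L \<le> (card B1 - card B0)\<^sup>2"
proof -
  obtain \<pi> where \<pi>: "lin \<pi>" "\<And>x. \<pi> x = 0 \<longleftrightarrow> x \<in> N" "\<And>x. x - \<pi> x \<in> N"
    using projection_exists[OF N] by blast
  let ?p = "word (map fst PQs)" and ?q = "word (map snd PQs)" and ?B = "box (length PQs) m"
  define Y where "Y = \<pi> ` (B1 - B0)"
  have Y: "finite Y" "card Y \<le> card B1 - card B0"
    using B card_image_le[of "B1 - B0" \<pi>] by (auto simp: Y_def card_Diff_subset)
  have \<pi>G: "\<pi> x \<in> span Y" if "x \<in> span B1" for x
  proof (rule lin_span[OF \<pi>(1) _ subspace_span that], rule image_subsetI)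
    fix b assume b: "b \<in> B1"
    show "\<pi> b \<in> span Y"
    proof (cases "b \<in> B0")
      case True
      then have "\<pi> b = 0" using B \<pi>(2) by auto
      then show ?thesis by (metis span_zero)
    next
      case False
      then show ?thesis using b by (auto simp: Y_def intro: span_base)
    qed
  qed
  \<comment> \<open>The images of the test vectors modulo \<open>N\<close>. They lie in
    \<open>span Y\<close>, so a basis \<open>X\<close> of their span has at most
    \<open>card Y\<close> elements. Source and target of the operators are thus bounded by the same
    number, which gives the square in the estimate.\<close>
  define Fs where "Fs = (\<lambda>ds. \<pi> (?q ds v)) ` ?B"
  obtain X where X: "X \<subseteq> Fs" "independent X" "Fs \<subseteq> span X"
    by (rule maximal_independent_subset)
  have "X \<subseteq> span Y" using X(1) G1 \<pi>G by (auto simp: Fs_def)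
  from independent_span_bound[OF Y(1) X(2) this] have cX: "finite X" "card X \<le> card Y" by auto
  define \<psi> where "\<psi> = (\<lambda>(as, i) x. \<pi> (?p as ((E ^^ i) x)))"
  let ?K = "?B \<times> {..<L}"
  have lp: "lin (?p as)" and lq: "lin (?q as)" for as
    using weyl_pairs_lin[OF W] by (auto intro!: lin_word)
  have lE: "lin (E ^^ i)" for i by (rule lin_funpow[OF E(1)])
  have l\<theta>: "lin (\<lambda>x. ?p as ((E ^^ i) x))" for as i by (rule lin_comp[OF lp lE])
  have l\<psi>: "lin (\<psi> k)" for k
    using lin_comp[OF \<pi>(1) l\<theta>[of "fst k" "snd k"]] by (simp add: \<psi>_def case_prod_unfold)
  have pN: "?p as x \<in> N" if "x \<in> N" for as x
  proof -
    have "word Ps as x \<in> N" if "set Ps \<subseteq> fst ` set PQs" for Ps as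
      using that
    proof (induction Ps arbitrary: as)
      case (Cons P Ps)
      then obtain Q where "(P, Q) \<in> set PQs" by auto
      then have "(P ^^ n) y \<in> N" if "y \<in> N" for n y
        using stab that by (intro funpow_in) auto
      then show ?case using Cons by simp
    qed (use \<open>x \<in> N\<close> in simp)
    then show ?thesis by simp
  qed
  have EN: "(E ^^ i) x \<in> N" if "x \<in> N" for x i by (rule funpow_in[where T = E, OF E(2) that])
  \<comment> \<open>The operators preserve \<open>N\<close>, so they descend to the quotient and may
    be evaluated on representatives.\<close>
  have \<psi>\<pi>: "\<psi> (as, i) (\<pi> x) = \<pi> (?p as ((E ^^ i) x))" for as i x
  proof -
    have "?p as ((E ^^ i) (x - \<pi> x)) \<in> N" by (intro pN EN \<pi>)
    then have "\<pi> (?p as ((E ^^ i) x) - ?p as ((E ^^ i) (\<pi> x))) = 0"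
      by (simp add: \<pi>(2) lin_diff[OF l\<theta>])
    then show ?thesis by (simp add: \<psi>_def lin_diff[OF \<pi>(1)])
  qed
  have "card ?K \<le> card X * card Y"
  proof (rule independent_operators_bound[where \<psi> = \<psi>])
    show "\<psi> k x \<in> span Y" if k: "k \<in> ?K" and x: "x \<in> X" for k x
    proof -
      from x X(1) obtain ds where "ds \<in> ?B" "x = \<pi> (?q ds v)" by (auto simp: Fs_def)
      then show ?thesis using k by (cases k) (auto simp: \<psi>\<pi> intro!: \<pi>G G2)
    qed
    fix c assume c: "\<forall>x\<in>X. (\<Sum>k\<in>?K. c k *s \<psi> k x) = 0"
    define T where "T x = (\<Sum>k\<in>?K. c k *s \<psi> k x)" for x
    have "lin T" unfolding lin_def T_def
      by (auto simp: lin_add[OF l\<psi>] lin_scale[OF l\<psi>] scale_right_distrib sum.distrib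
          scale_sum_right mult.commute)
    from lin_span[OF this, of X "{0}"] c X(3) have T: "T x = 0" if "x \<in> Fs" for x
      using that by (auto simp: T_def subspace_def)
    \<comment> \<open>The relation among the operators is sorted by the monomials in the
      \<open>P\<close>; each coefficient is a polynomial in \<open>E\<close> applied to
      \<open>v\<close>. Separation puts it in \<open>N\<close>, and the hypothesis on
      \<open>v\<close> then makes all its coefficients zero.\<close>
    define u where "u as = (\<Sum>i<L. c (as, i) *s (E ^^ i) v)" for as
    have Eq: "?q ds ((E ^^ i) x) = (E ^^ i) (?q ds x)" for ds i x
    proof (rule word_commute)
      fix Q x assume "Q \<in> set (map snd PQs)"
      then obtain P where "(P, Q) \<in> set PQs" by auto
      then show "Q (E x) = E (Q x)" by (rule EQ)
    qed
    have "(\<Sum>as\<in>?B. ?p as (?q ds (u as))) \<in> N" if ds: "ds \<in> ?B" for ds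
    proof -
      have "\<pi> (\<Sum>as\<in>?B. ?p as (?q ds (u as))) = (\<Sum>as\<in>?B. \<Sum>i<L. c (as, i) *s \<pi> (?p as ((E ^^ i) (?q ds v))))"
        by (simp only: u_def lin_sum[OF \<pi>(1)] lin_sum[OF lp] lin_sum[OF lq] lin_scale[OF lp]
            lin_scale[OF lq] lin_scale[OF \<pi>(1)] Eq)
      also have "\<dots> = T (\<pi> (?q ds v))"
        using \<psi>\<pi>[of "fst k" "snd k" for k] by (simp add: T_def sum.cartesian_product case_prod_unfold)
      also have "\<dots> = 0" using ds by (intro T) (auto simp: Fs_def)
      finally show ?thesis using \<pi>(2) by simp
    qed
    then have "u as \<in> N" if "as \<in> ?B" for as
      by (intro weyl_separation_multi[where as = as and u = u and PQs = PQs and m = m]) (use W N stab that in auto)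
    then show "\<forall>k\<in>?K. c k = 0" using v[of "\<lambda>i. c (_, i)"] by (auto simp: u_def)
  qed (use Y cX finite_box in auto)
  also have "\<dots> \<le> (card B1 - card B0)\<^sup>2"
    using Y(2) cX(2) by (simp add: power2_eq_square mult_mono)
  finally show ?thesis by (simp add: card_box card_cartesian_product)
qed

end

section \<open>Derivations of polynomial rings\<close>

lemma poly_mapping_single_induct:
  assumes "\<And>a c. P (Poly_Mapping.single a c)" "\<And>f g. P f \<Longrightarrow> P g \<Longrightarrow> P (f + g)"
  shows "P (f :: 'a \<Rightarrow>\<^sub>0 'b::comm_monoid_add)"
proof (induction f rule: update_induct)
  case const
  show ?case using assms(1)[of undefined 0] by simp
next
  case (update f a b)
  have "Poly_Mapping.update a b f = Poly_Mapping.single a b + f"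
    using update by (intro poly_mapping_eqI)
      (auto simp: lookup_update lookup_add lookup_single in_keys_iff)
  then show ?case using assms update by metis
qed

section \<open>Polynomials generated by constants and variables\<close>

definition var :: "'v \<Rightarrow> ('v, 'k::comm_ring_1) mpoly" where
  "var j = Poly_Mapping.single (Poly_Mapping.single j 1) 1"

abbreviation mon :: "('v \<Rightarrow>\<^sub>0 nat) \<Rightarrow> ('v, 'k::comm_ring_1) mpoly" where
  "mon \<alpha> \<equiv> Poly_Mapping.single \<alpha> 1"

lemma const_mult_single: "const c * Poly_Mapping.single \<alpha> d = Poly_Mapping.single \<alpha> (c * d)"
  by (simp add: const_def mult_single)

lemma const_1: "const 1 = 1" and const_0: "const 0 = 0"
  and const_add: "const (a + b) = const a + const b"
  and const_mult: "const (a * b) = const a * const b"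
  by (simp_all add: const_def single_add mult_single)

lemma mpoly_induct [case_names const var add mult]:
  assumes "\<And>c. P (const c)" "\<And>j. P (var j)" "\<And>f g. P f \<Longrightarrow> P g \<Longrightarrow> P (f + g)"
    "\<And>f g. P f \<Longrightarrow> P g \<Longrightarrow> P (f * g)"
  shows "P (f :: ('v, 'k::comm_ring_1) mpoly)"
proof (induction f rule: poly_mapping_single_induct)
  case (1 \<alpha> c)
  have "P (mon \<alpha>)"
  proof (induction \<alpha> rule: poly_mapping_single_induct)
    case (1 j n)
    show ?case
    proof (induction n)
      case 0
      show ?case using assms(1)[of 1] by (simp add: const_def)
    next
      case (Suc n)
      have "mon (Poly_Mapping.single j (Suc n)) = var j * mon (Poly_Mapping.single j n)"
        by (simp add: var_def mult_single flip: single_add)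
      then show ?case using assms(2,4) Suc by metis
    qed
  next
    case (2 \<alpha> \<beta>)
    have "mon (\<alpha> + \<beta>) = mon \<alpha> * mon \<beta>" by (simp add: mult_single)
    then show ?case using assms(4) 2 by metis
  qed
  then have "P (const c * mon \<alpha>)" using assms by blast
  then show ?case by (simp add: const_mult_single)
next
  case (2 f g)
  then show ?case using assms by blast
qed

text \<open>The partial derivative by \<open>x_j\<close>. Where \<open>x_j\<close> does not occur in
  a monomial, the exponent subtraction truncates, but the coefficient is zero.\<close>

definition pd :: "'v \<Rightarrow> ('v, 'k::comm_ring_1) mpoly \<Rightarrow> ('v, 'k) mpoly" where
  "pd j f = (\<Sum>\<alpha>\<in>Poly_Mapping.keys f. Poly_Mapping.single (\<alpha> - Poly_Mapping.single j 1)
     (of_nat (Poly_Mapping.lookup \<alpha> j) * Poly_Mapping.lookup f \<alpha>))"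

text \<open>Lets the sums for \<open>f\<close>, \<open>g\<close> and \<open>f + g\<close> run over
  one common index set.\<close>

lemma pd_superset:
  assumes "finite K" "Poly_Mapping.keys f \<subseteq> K"
  shows "pd j f = (\<Sum>\<alpha>\<in>K. Poly_Mapping.single (\<alpha> - Poly_Mapping.single j 1)
     (of_nat (Poly_Mapping.lookup \<alpha> j) * Poly_Mapping.lookup f \<alpha>))"
  unfolding pd_def using assms by (intro sum.mono_neutral_left) (auto simp: in_keys_iff)

lemma pd_add: "pd j (f + g) = pd j f + pd j g"
proof -
  let ?K = "Poly_Mapping.keys f \<union> Poly_Mapping.keys g"
  have "Poly_Mapping.keys (f + g) \<subseteq> ?K" by (rule Poly_Mapping.keys_add)
  then show ?thesis
    by (simp add: pd_superset[of ?K] lookup_add distrib_left single_add sum.distrib)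
qed

lemma pd_single: "pd j (Poly_Mapping.single \<alpha> c) =
    Poly_Mapping.single (\<alpha> - Poly_Mapping.single j 1) (of_nat (Poly_Mapping.lookup \<alpha> j) * c)"
  by (subst pd_superset[of "{\<alpha>}"]) auto

lemma exponent_shift:
  "Poly_Mapping.lookup \<alpha> j > 0 \<Longrightarrow> \<alpha> + \<beta> - Poly_Mapping.single j (1::nat) = \<alpha> - Poly_Mapping.single j 1 + \<beta>"
  by (rule poly_mapping_eqI) (auto simp: lookup_add lookup_minus lookup_single when_def)

lemma pd_mult: "pd j (f * g) = f * pd j g + g * pd j f"
proof (induction f rule: poly_mapping_single_induct)
  case (1 \<alpha> a)
  show ?case
  proof (induction g rule: poly_mapping_single_induct)
    case (1 \<beta> b)
    have "Poly_Mapping.single (\<alpha> + \<beta> - Poly_Mapping.single j 1) (of_nat (Poly_Mapping.lookup \<alpha> j) * (a * b))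
      = Poly_Mapping.single (\<alpha> - Poly_Mapping.single j 1 + \<beta>) (of_nat (Poly_Mapping.lookup \<alpha> j) * (a * b))"
      by (cases "Poly_Mapping.lookup \<alpha> j = 0") (simp_all only: exponent_shift, simp_all)
    moreover have "Poly_Mapping.single (\<beta> + \<alpha> - Poly_Mapping.single j 1) (of_nat (Poly_Mapping.lookup \<beta> j) * (a * b))
      = Poly_Mapping.single (\<beta> - Poly_Mapping.single j 1 + \<alpha>) (of_nat (Poly_Mapping.lookup \<beta> j) * (a * b))"
      by (cases "Poly_Mapping.lookup \<beta> j = 0") (simp_all only: exponent_shift, simp_all)
    ultimately show ?case
      by (simp add: mult_single pd_single lookup_add distrib_right distrib_left single_add ac_simps)
  qed (simp add: pd_add algebra_simps)
qed (simp add: pd_add algebra_simps)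

lemma pd_const: "pd j (const c) = 0"
  by (simp add: const_def pd_single)

lemma pd_var: "pd j (var i) = (if i = j then 1 else 0)"
  by (auto simp: var_def pd_single lookup_single)

lemma pd_Der: "pd j \<in> Der"
  by (simp add: Der_def pd_add pd_mult pd_const)

section \<open>Derivations, their brackets and their expansion in partial derivatives\<close>

lemma Der_add: "\<eta> \<in> Der \<Longrightarrow> \<eta> (f + g) = \<eta> f + \<eta> g"
  and Der_cmult: "\<eta> \<in> Der \<Longrightarrow> \<eta> (const c * f) = const c * \<eta> f"
  and Der_mult: "\<eta> \<in> Der \<Longrightarrow> \<eta> (f * g) = f * \<eta> g + g * \<eta> f"
  by (auto simp: Der_def)

lemma Der_plus: "\<eta> \<in> Der \<Longrightarrow> \<xi> \<in> Der \<Longrightarrow> (\<lambda>g. \<eta> g + \<xi> g) \<in> Der"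
  by (auto simp: Der_def algebra_simps)

lemma Der_Amul: "\<eta> \<in> Der \<Longrightarrow> Amul_V f \<eta> \<in> Der"
  by (auto simp: Der_def Amul_V_def algebra_simps)

lemma Der_const: "\<eta> \<in> Der \<Longrightarrow> \<eta> (const c) = 0"
proof -
  assume \<eta>: "\<eta> \<in> Der"
  have "\<eta> (1 * 1) = \<eta> 1 + \<eta> 1" using Der_mult[OF \<eta>, of 1 1] by simp
  then have "\<eta> 1 = 0" by simp
  then show ?thesis using Der_cmult[OF \<eta>, of c 1] by simp
qed

lemma Der_0: "\<eta> \<in> Der \<Longrightarrow> \<eta> 0 = 0"
  using Der_const[of \<eta> 0] by (simp add: const_0)

lemma Der_1: "\<eta> \<in> Der \<Longrightarrow> \<eta> 1 = 0"
  using Der_const[of \<eta> 1] by (simp add: const_1)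

lemma Der_bracket:
  assumes "\<eta> \<in> Der" "\<xi> \<in> Der"
  shows "bracket \<eta> \<xi> \<in> Der"
proof -
  have "bracket \<eta> \<xi> (const c * f) = const c * bracket \<eta> \<xi> f" for c f
    by (simp add: bracket_def Der_cmult[OF assms(1)] Der_cmult[OF assms(2)] right_diff_distrib)
  moreover have "bracket \<eta> \<xi> (f * g) = f * bracket \<eta> \<xi> g + g * bracket \<eta> \<xi> f" for f g
    by (simp add: bracket_def Der_add[OF assms(1)] Der_add[OF assms(2)] Der_mult[OF assms(1)]
        Der_mult[OF assms(2)]) (simp add: algebra_simps)
  moreover have "bracket \<eta> \<xi> (f + g) = bracket \<eta> \<xi> f + bracket \<eta> \<xi> g" for f g
    by (simp add: bracket_def Der_add[OF assms(1)] Der_add[OF assms(2)])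
  ultimately show ?thesis by (simp add: Der_def)
qed

text \<open>Constants and variables generate the polynomial ring, and derivations kill constants.
  Identities between brackets are hereby reduced to evaluation at the variables.\<close>

lemma Der_eqI:
  assumes "\<eta> \<in> Der" "\<xi> \<in> Der" "\<And>j. \<eta> (var j) = \<xi> (var j)"
  shows "\<eta> = \<xi>"
proof
  fix f show "\<eta> f = \<xi> f"
    by (induction f rule: mpoly_induct)
      (auto simp: assms Der_const Der_add[OF assms(1)] Der_add[OF assms(2)]
        Der_mult[OF assms(1)] Der_mult[OF assms(2)])
qed

lemma zero_Der: "(\<lambda>g. 0) \<in> Der"
  by (simp add: Der_def)

lemma sum_Der: "(\<And>i. i \<in> I \<Longrightarrow> \<eta> i \<in> Der) \<Longrightarrow> (\<lambda>g. \<Sum>i\<in>I. \<eta> i g) \<in> Der"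
  by (induction I rule: infinite_finite_induct) (auto simp: zero_Der Der_plus)

lemma Der_expand:
  fixes \<eta> :: "('v::finite, 'k::comm_ring_1) mpoly \<Rightarrow> ('v, 'k) mpoly"
  assumes "\<eta> \<in> Der"
  shows "\<eta> = (\<lambda>g. \<Sum>i\<in>UNIV. Amul_V (\<eta> (var i)) (pd i) g)"
proof (rule Der_eqI[OF assms])
  show "(\<lambda>g. \<Sum>i\<in>UNIV. Amul_V (\<eta> (var i)) (pd i) g) \<in> Der"
    by (intro sum_Der Der_Amul pd_Der)
  show "\<eta> (var j) = (\<Sum>i\<in>UNIV. Amul_V (\<eta> (var i)) (pd i) (var j))" for j
    by (simp add: Amul_V_def pd_var if_distrib[of "(*) _"] cong: if_cong)
qed

lemma pd_commute: "bracket (pd i) (pd j) = (\<lambda>g. 0)"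
proof (rule Der_eqI)
  show "bracket (pd i) (pd j) \<in> Der" "(\<lambda>g. 0) \<in> Der" by (intro Der_bracket pd_Der zero_Der)+
  show "bracket (pd i) (pd j) (var k) = 0" for k
    by (simp add: bracket_def pd_var Der_0[OF pd_Der] Der_1[OF pd_Der])
qed

lemma bracket_pd_mon: "bracket (pd j) (Amul_V (mon \<gamma>) (pd i)) =
    Amul_V (const (of_nat (Poly_Mapping.lookup \<gamma> j)) * mon (\<gamma> - Poly_Mapping.single j 1)) (pd i)"
proof (rule Der_eqI)
  fix k
  show "bracket (pd j) (Amul_V (mon \<gamma>) (pd i)) (var k) =
      Amul_V (const (of_nat (Poly_Mapping.lookup \<gamma> j)) * mon (\<gamma> - Poly_Mapping.single j 1)) (pd i) (var k)"
    by (simp add: bracket_def Amul_V_def pd_var pd_single const_mult_single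
        Der_0[OF pd_Der] Der_1[OF pd_Der])
qed (intro Der_bracket Der_Amul pd_Der)+

text \<open>The identity \<open>[x_k^2 d_k, x^\<gamma> d_i] = (\<gamma>_k - 2 [i = k]) x^(\<gamma> +
  e_k) d_i\<close>. The lower bound on the exponent makes the subtraction of natural numbers agree
  with that in the field.\<close>

lemma bracket_raise:
  fixes k :: 'v
  assumes "Poly_Mapping.lookup \<gamma> k \<ge> 2"
  shows "bracket (Amul_V (mon (Poly_Mapping.single k 2)) (pd k)) (Amul_V (mon \<gamma>) (pd i)) =
    Amul_V (const (of_nat (Poly_Mapping.lookup \<gamma> k - (if i = k then 2 else 0)) :: 'k::comm_ring_1)
      * mon (\<gamma> + Poly_Mapping.single k 1)) (pd i)"
proof (rule Der_eqI)
  fix j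
  have e1: "Poly_Mapping.single k 2 + (\<gamma> - Poly_Mapping.single k (Suc 0)) = \<gamma> + Poly_Mapping.single k (Suc 0)"
    using assms by (intro poly_mapping_eqI) (auto simp: lookup_add lookup_minus lookup_single when_def)
  have e2: "\<gamma> + (Poly_Mapping.single k 2 - Poly_Mapping.single k (Suc 0)) = \<gamma> + Poly_Mapping.single k (Suc 0)"
    by (intro poly_mapping_eqI) (auto simp: lookup_add lookup_minus lookup_single when_def)
  have "(of_nat (Poly_Mapping.lookup \<gamma> k - 2) :: 'k) = of_nat (Poly_Mapping.lookup \<gamma> k) - 2"
    using assms by (simp add: of_nat_diff)
  then show "bracket (Amul_V (mon (Poly_Mapping.single k 2)) (pd k)) (Amul_V (mon \<gamma>) (pd i)) (var j) =
    Amul_V (const (of_nat (Poly_Mapping.lookup \<gamma> k - (if i = k then 2 else 0)) :: 'k)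
      * mon (\<gamma> + Poly_Mapping.single k 1)) (pd i) (var j)"
    by (auto simp: bracket_def Amul_V_def pd_var pd_single const_mult_single mult_single e1 e2
      Der_0[OF pd_Der] Der_1[OF pd_Der] lookup_single single_diff)
qed (intro Der_bracket Der_Amul pd_Der)+

section \<open>Iterated differences of the representation\<close>

locale AV =
  fixes actA :: "('v::finite, 'k::field_char_0) mpoly \<Rightarrow> 'm::ab_group_add \<Rightarrow> 'm"
    and actV :: "(('v, 'k) mpoly \<Rightarrow> ('v, 'k) mpoly) \<Rightarrow> 'm \<Rightarrow> 'm"
  assumes AV: "AV_module actA actV"
begin

abbreviation scl :: "'k \<Rightarrow> 'm \<Rightarrow> 'm" (infixr \<open>*s\<close> 75) where
  "scl \<equiv> smul actA"

lemma A_add: "actA f (x + y) = actA f x + actA f y"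
  and A_plus: "actA (f + g) x = actA f x + actA g x"
  and A_mult: "actA (f * g) x = actA f (actA g x)"
  and A_1: "actA 1 x = x"
  using AV by (auto simp: AV_module_def)

lemma V_add: "\<eta> \<in> Der \<Longrightarrow> actV \<eta> (x + y) = actV \<eta> x + actV \<eta> y"
  and V_scale: "\<eta> \<in> Der \<Longrightarrow> actV \<eta> (c *s x) = c *s actV \<eta> x"
  and V_plus: "\<eta> \<in> Der \<Longrightarrow> \<xi> \<in> Der \<Longrightarrow> actV (\<lambda>g. \<eta> g + \<xi> g) x = actV \<eta> x + actV \<xi> x"
  and V_cmult: "\<eta> \<in> Der \<Longrightarrow> actV (\<lambda>g. const c * \<eta> g) x = c *s actV \<eta> x"
  and V_bracket: "\<eta> \<in> Der \<Longrightarrow> \<xi> \<in> Der \<Longrightarrow>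
    actV (bracket \<eta> \<xi>) x = actV \<eta> (actV \<xi> x) - actV \<xi> (actV \<eta> x)"
  and V_A: "\<eta> \<in> Der \<Longrightarrow> actV \<eta> (actA f x) = actA (\<eta> f) x + actA f (actV \<eta> x)"
  using AV by (auto simp: AV_module_def)

sublocale char0_space scl
  by unfold_locales (auto simp: smul_def A_add A_plus A_mult A_1 const_add const_mult const_1)

lemma A_comm: "actA f (actA g x) = actA g (actA f x)"
  by (metis A_mult mult.commute)

lemma A_scale: "actA f (c *s x) = c *s actA f x"
  by (simp add: smul_def A_comm)

lemma A_const: "actA (const c) x = c *s x"
  by (simp add: smul_def)

lemma lin_A: "lin (actA f)"
  by (simp add: lin_def A_add A_scale)

lemma lin_V: "\<eta> \<in> Der \<Longrightarrow> lin (actV \<eta>)"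
  by (simp add: lin_def V_add V_scale)

lemmas A_diff = lin_diff[OF lin_A] and A_zero = lin_0[OF lin_A]

lemma A_0: "actA 0 x = 0"
  using A_const[of 0 x] by (simp add: const_0)

lemma Hom_delta: "Hom_V_End actA D \<Longrightarrow> Hom_V_End actA (delta actA f D)"
proof -
  assume D: "Hom_V_End actA D"
  have 1: "Amul_V f (\<lambda>g. \<eta> g + \<xi> g) = (\<lambda>g. Amul_V f \<eta> g + Amul_V f \<xi> g)" for \<eta> \<xi>
    by (simp add: Amul_V_def distrib_left)
  have 2: "Amul_V f (\<lambda>g. const c * \<eta> g) = (\<lambda>g. const c * Amul_V f \<eta> g)" for c \<eta>
    by (simp add: Amul_V_def ac_simps)
  show ?thesis using D
    unfolding Hom_V_End_def delta_def 1 2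
    by (auto simp: Der_Amul A_add A_scale scale_right_diff_distrib)
qed

lemma Hom_V: "Hom_V_End actA actV"
  by (simp add: Hom_V_End_def V_add V_scale V_plus V_cmult)

lemma Hom_lin: "Hom_V_End actA D \<Longrightarrow> \<eta> \<in> Der \<Longrightarrow> lin (D \<eta>)"
  by (simp add: Hom_V_End_def lin_def)

lemma Hom_plus: "Hom_V_End actA D \<Longrightarrow> \<eta> \<in> Der \<Longrightarrow> \<xi> \<in> Der \<Longrightarrow>
    D (\<lambda>g. \<eta> g + \<xi> g) x = D \<eta> x + D \<xi> x"
  by (simp add: Hom_V_End_def)

lemma Hom_cmult: "Hom_V_End actA D \<Longrightarrow> \<eta> \<in> Der \<Longrightarrow> D (\<lambda>g. const c * \<eta> g) x = c *s D \<eta> x"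
  by (simp add: Hom_V_End_def)

lemma Der_minus: "\<eta> \<in> Der \<Longrightarrow> \<xi> \<in> Der \<Longrightarrow> (\<lambda>g. \<eta> g - \<xi> g) \<in> Der"
  using Der_plus[OF _ Der_Amul[of \<xi> "-1"], of \<eta>] by (simp add: Amul_V_def)

lemma Hom_minus:
  assumes "Hom_V_End actA D" "\<eta> \<in> Der" "\<xi> \<in> Der"
  shows "D (\<lambda>g. \<eta> g - \<xi> g) x = D \<eta> x - D \<xi> x"
  using Hom_plus[OF assms(1) Der_minus[OF assms(2,3)] assms(3), of x] by simp

lemma Hom_zero: "Hom_V_End actA D \<Longrightarrow> D (\<lambda>g. 0) x = 0"
  using Hom_cmult[of D "\<lambda>g. 0" 0 x] by (simp add: zero_Der)

text \<open>Explicitly, \<open>J f a \<eta>\<close> is the alternating sum over \<open>i\<close> of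
  \<open>(-1)^(a-i) (a choose i) f^(a-i) \<rho>(f^i \<eta>)\<close>.\<close>

definition J :: "('v, 'k) mpoly \<Rightarrow> nat \<Rightarrow> (('v, 'k) mpoly \<Rightarrow> ('v, 'k) mpoly) \<Rightarrow> 'm \<Rightarrow> 'm" where
  "J f a = (delta actA f ^^ a) actV"

lemma J_0: "J f 0 = actV"
  by (simp add: J_def)

lemma J_Suc: "J f (Suc a) \<eta> x = J f a (Amul_V f \<eta>) x - actA f (J f a \<eta> x)"
  by (simp add: J_def delta_def)

lemma Hom_J: "Hom_V_End actA (J f a)"
  by (induction a) (simp_all add: J_def Hom_V Hom_delta)

lemmas J_plus = Hom_plus[OF Hom_J] and J_minus = Hom_minus[OF Hom_J] and J_zero = Hom_zero[OF Hom_J]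
  and lin_J = Hom_lin[OF Hom_J]

text \<open>One difference already removes the derivation part: by the Leibniz rule the commutator
  of \<open>\<rho>(f \<eta>) - f \<rho>(\<eta>)\<close> with \<open>g\<close> is
  \<open>(f \<eta>)(g) - f \<eta>(g) = 0\<close>. Further differences preserve this
  linearity.\<close>

lemma J_A: "\<eta> \<in> Der \<Longrightarrow> J f (Suc a) \<eta> (actA g x) = actA g (J f (Suc a) \<eta> x)"
proof (induction a arbitrary: \<eta>)
  case 0
  then show ?case
    by (simp add: J_Suc J_0 V_A Der_Amul A_diff)
      (simp add: Amul_V_def A_mult A_add A_comm[of g f] flip: diff_diff_eq)
next
  case (Suc a)
  from Suc.prems have "J f (Suc (Suc a)) \<eta> (actA g x)
      = actA g (J f (Suc a) (Amul_V f \<eta>) x) - actA f (actA g (J f (Suc a) \<eta> x))"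
    by (simp only: J_Suc[of f "Suc a"] Suc.IH Der_Amul)
  then show ?case
    by (simp only: J_Suc[of f "Suc a"] A_diff A_comm[of f g])
qed

section \<open>Commutators of iterated differences\<close>

lemma Amul_Amul: "Amul_V f (Amul_V g \<eta>) = Amul_V g (Amul_V f \<eta>)"
  by (simp add: Amul_V_def ac_simps)

lemma bracket_Amul_right: "\<eta> \<in> Der \<Longrightarrow>
    bracket \<eta> (Amul_V f \<zeta>) = (\<lambda>g. Amul_V (\<eta> f) \<zeta> g + Amul_V f (bracket \<eta> \<zeta>) g)"
  by (simp add: bracket_def Amul_V_def Der_mult algebra_simps)

lemma bracket_Amul_left: "\<zeta> \<in> Der \<Longrightarrow>
    bracket (Amul_V f \<eta>) \<zeta> = (\<lambda>g. Amul_V f (bracket \<eta> \<zeta>) g - Amul_V (\<zeta> f) \<eta> g)"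
  by (simp add: bracket_def Amul_V_def Der_mult algebra_simps)

lemma V_J_commutator:
  assumes "\<eta> \<in> Der" "\<zeta> \<in> Der"
  shows "actV \<eta> (J f b \<zeta> x) = J f b \<zeta> (actV \<eta> x) + J f b (bracket \<eta> \<zeta>) x
    + of_nat b *s (J f (b - 1) (Amul_V (\<eta> f) \<zeta>) x - actA (\<eta> f) (J f (b - 1) \<zeta> x))"
  using assms(2)
proof (induction b arbitrary: \<zeta>)
  case 0
  then show ?case using assms(1) by (simp add: J_0 V_bracket)
next
  case (Suc b)
  note Ders = assms(1) Suc.prems Der_Amul Der_bracket
  \<comment> \<open>One factor \<open>f\<close> is absorbed into a further difference, raising the
    index \<open>b - 1\<close> to \<open>b\<close>; the rest cancels against the expansion of
    \<open>actA f (actV \<eta> (J f b \<zeta> x))\<close>.\<close>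
  have key: "of_nat b *s (J f (b - 1) (Amul_V (\<eta> f) (Amul_V f \<zeta>)) x - actA (\<eta> f) (J f (b - 1) (Amul_V f \<zeta>) x))
    = of_nat b *s (J f b (Amul_V (\<eta> f) \<zeta>) x - actA (\<eta> f) (J f b \<zeta> x))
     + of_nat b *s actA f (J f (b - 1) (Amul_V (\<eta> f) \<zeta>) x - actA (\<eta> f) (J f (b - 1) \<zeta> x))"
    by (cases b) (simp_all add: J_Suc A_diff A_comm[of f] Amul_Amul[of f] algebra_simps)
  have "actV \<eta> (J f (Suc b) \<zeta> x) = actV \<eta> (J f b (Amul_V f \<zeta>) x)
      - actA (\<eta> f) (J f b \<zeta> x) - actA f (actV \<eta> (J f b \<zeta> x))"
    by (simp add: J_Suc lin_diff[OF lin_V] Ders V_A)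
  also have "actV \<eta> (J f b (Amul_V f \<zeta>) x) = J f b (Amul_V f \<zeta>) (actV \<eta> x)
      + (J f b (Amul_V (\<eta> f) \<zeta>) x + J f b (Amul_V f (bracket \<eta> \<zeta>)) x)
      + (of_nat b *s (J f b (Amul_V (\<eta> f) \<zeta>) x - actA (\<eta> f) (J f b \<zeta> x))
     + of_nat b *s actA f (J f (b - 1) (Amul_V (\<eta> f) \<zeta>) x - actA (\<eta> f) (J f (b - 1) \<zeta> x)))"
    by (simp only: Suc.IH[OF Der_Amul[OF Suc.prems]] key)
      (simp add: bracket_Amul_right J_plus Ders)
  also have "actA f (actV \<eta> (J f b \<zeta> x)) = actA f (J f b \<zeta> (actV \<eta> x)) + actA f (J f b (bracket \<eta> \<zeta>) x)
     + of_nat b *s actA f (J f (b - 1) (Amul_V (\<eta> f) \<zeta>) x - actA (\<eta> f) (J f (b - 1) \<zeta> x))"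
    by (simp only: Suc.IH[OF Suc.prems] A_add A_scale)
  finally show ?case by (simp add: J_Suc scale_left_distrib)
qed

text \<open>Induction on \<open>a\<close>: the formula for \<open>f \<eta>\<close> minus
  \<open>f\<close> times the formula for \<eta>. The identity \<open>[f \<eta>, \<zeta>] = f
  [\<eta>, \<zeta>] - \<zeta>(f) \<eta>\<close> supplies one more copy of the last term, which
  raises its coefficient from \<open>Suc a\<close> to \<open>Suc (Suc a)\<close>.\<close>

lemma J_commutator:
  assumes "\<eta> \<in> Der" "\<zeta> \<in> Der"
  shows "J f (Suc a) \<eta> (J f (Suc b) \<zeta> x) = J f (Suc b) \<zeta> (J f (Suc a) \<eta> x)
    + J f (Suc (Suc (a + b))) (bracket \<eta> \<zeta>) x
    + of_nat (Suc b) *s J f (Suc (a + b)) (Amul_V (\<eta> f) \<zeta>) x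
    - of_nat (Suc a) *s J f (Suc (a + b)) (Amul_V (\<zeta> f) \<eta>) x"
  using assms(1)
proof (induction a arbitrary: \<eta>)
  case 0
  note D = 0 assms(2)
  have d: "Amul_V f \<eta> f = f * \<eta> f" by (simp add: Amul_V_def)
  have s: "Amul_V (f * g) \<zeta> = Amul_V f (Amul_V g \<zeta>)" for g by (simp add: Amul_V_def ac_simps)
  let ?y = "J f (Suc b) \<zeta> x"
  have "J f (Suc 0) \<eta> ?y = actV (Amul_V f \<eta>) ?y - actA f (actV \<eta> ?y)"
    by (simp only: J_Suc[of f 0] J_0)
  also have "actV (Amul_V f \<eta>) ?y = J f (Suc b) \<zeta> (actV (Amul_V f \<eta>) x)
      + (J f (Suc b) (Amul_V f (bracket \<eta> \<zeta>)) x - J f (Suc b) (Amul_V (\<zeta> f) \<eta>) x)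
      + of_nat (Suc b) *s (J f b (Amul_V f (Amul_V (\<eta> f) \<zeta>)) x - actA f (actA (\<eta> f) (J f b \<zeta> x)))"
    by (simp only: V_J_commutator[OF Der_Amul[OF 0] D(2)] bracket_Amul_left[OF D(2)] d s diff_Suc_1
        J_minus[OF Der_Amul[OF Der_bracket[OF D]] Der_Amul[OF 0]] A_mult)
  also have "actA f (actV \<eta> ?y) = J f (Suc b) \<zeta> (actA f (actV \<eta> x)) + actA f (J f (Suc b) (bracket \<eta> \<zeta>) x)
      + of_nat (Suc b) *s (actA f (J f b (Amul_V (\<eta> f) \<zeta>) x) - actA f (actA (\<eta> f) (J f b \<zeta> x)))"
    by (simp only: V_J_commutator[OF D] A_add A_scale A_diff diff_Suc_1 J_A[OF D(2)])
  also have "J f (Suc b) \<zeta> (actV (Amul_V f \<eta>) x) = J f (Suc b) \<zeta> (J f (Suc 0) \<eta> x + actA f (actV \<eta> x))"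
    by (simp add: J_Suc[of f 0] J_0)
  finally show ?case
    by (simp only: lin_add[OF lin_J[OF D(2)]] add_0 J_Suc[of f b "Amul_V (\<eta> f) \<zeta>"]
        J_Suc[of f "Suc b" "bracket \<eta> \<zeta>"] scale_right_diff_distrib) (simp add: algebra_simps)
next
  case (Suc a)
  note D = Suc.prems assms(2)
  let ?y = "J f (Suc b) \<zeta> x" and ?c = "Suc (a + b)"
  have d: "Amul_V f \<eta> f = f * \<eta> f" by (simp add: Amul_V_def)
  have s: "Amul_V (f * g) \<zeta> = Amul_V f (Amul_V g \<zeta>)" for g by (simp add: Amul_V_def ac_simps)
  have "J f (Suc (Suc a)) \<eta> ?y = J f (Suc a) (Amul_V f \<eta>) ?y - actA f (J f (Suc a) \<eta> ?y)"
    by (simp only: J_Suc[of f "Suc a"])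
  also have "J f (Suc a) (Amul_V f \<eta>) ?y = J f (Suc b) \<zeta> (J f (Suc a) (Amul_V f \<eta>) x)
      + (J f (Suc ?c) (Amul_V f (bracket \<eta> \<zeta>)) x - J f (Suc ?c) (Amul_V (\<zeta> f) \<eta>) x)
      + of_nat (Suc b) *s J f ?c (Amul_V f (Amul_V (\<eta> f) \<zeta>)) x
      - of_nat (Suc a) *s J f ?c (Amul_V f (Amul_V (\<zeta> f) \<eta>)) x"
    by (simp only: Suc.IH[OF Der_Amul[OF D(1)]] bracket_Amul_left[OF D(2)] d s
        J_minus[OF Der_Amul[OF Der_bracket[OF D]] Der_Amul[OF D(1)]] Amul_Amul[of _ f])
  also have "actA f (J f (Suc a) \<eta> ?y) = J f (Suc b) \<zeta> (actA f (J f (Suc a) \<eta> x))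
      + actA f (J f (Suc ?c) (bracket \<eta> \<zeta>) x)
      + of_nat (Suc b) *s actA f (J f ?c (Amul_V (\<eta> f) \<zeta>) x)
      - of_nat (Suc a) *s actA f (J f ?c (Amul_V (\<zeta> f) \<eta>) x)"
    by (simp only: Suc.IH[OF D(1)] A_add A_scale A_diff J_A[OF D(2)])
  also have "J f (Suc b) \<zeta> (J f (Suc a) (Amul_V f \<eta>) x)
      = J f (Suc b) \<zeta> (J f (Suc (Suc a)) \<eta> x + actA f (J f (Suc a) \<eta> x))"
    by (simp add: J_Suc[of f "Suc a"])
  finally show ?case
    by (simp only: lin_add[OF lin_J[OF D(2)]] add_Suc J_Suc[of f ?c "Amul_V (\<eta> f) \<zeta>"]
        J_Suc[of f ?c "Amul_V (\<zeta> f) \<eta>"] J_Suc[of f "Suc ?c" "bracket \<eta> \<zeta>"]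
        scale_right_diff_distrib of_nat_Suc[of "Suc a"] scale_left_distrib scale_one)
      (simp only: algebra_simps)
qed

section \<open>The operators \<open>t_a\<close> and their commutation relations\<close>

abbreviation t :: "'v \<Rightarrow> nat \<Rightarrow> 'm \<Rightarrow> 'm" where
  "t j a \<equiv> J (var j) a (pd j)"

lemma pd_var_const: "pd k (var j) = const (if j = k then 1 else 0)"
  by (simp add: pd_var const_1 const_0)

text \<open>Partial derivatives commute and \<open>pd k (var j)\<close> is a constant, whose
  difference is zero; both correction terms of \<open>V_J_commutator\<close> vanish.\<close>

lemma t_pd: "actV (pd k) (t j b x) = t j b (actV (pd k) x)"
proof -
  have "J f a (Amul_V (const c) (pd j)) x = c *s J f a (pd j) x" for f a c
    using Hom_cmult[OF Hom_J pd_Der] by (simp add: Amul_V_def)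
  then show ?thesis
    by (simp add: V_J_commutator[OF pd_Der pd_Der] pd_commute J_zero pd_var_const A_const)
qed

text \<open>The two correction terms of \<open>J_commutator\<close> have coefficients
  \<open>b + 1\<close> and \<open>-1\<close> on the same operator, leaving weight
  \<open>b\<close>.\<close>

lemma t_weight: "t j 1 (t j (Suc b) x) = t j (Suc b) (t j 1 x) + of_nat b *s t j (Suc b) x"
  using J_commutator[OF pd_Der pd_Der, of "var j" 0 j b j x]
  by (simp add: pd_commute J_zero pd_var Amul_V_def scale_left_distrib)

text \<open>If \<open>t_a\<close> is zero, its commutator with \<open>J\<close> is zero, a linear
  relation among three operators that depend on \<open>a + b\<close> only, while the coefficients
  depend on \<open>a\<close> and \<open>b\<close> separately. Comparing two splittings of one sum
  leaves two of the operators.\<close>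

lemma J_vanish:
  assumes \<zeta>: "\<zeta> \<in> Der" and t: "\<And>a x. a \<ge> N \<Longrightarrow> t j a x = 0" and c: "c \<ge> N + 2"
  shows "J (var j) c \<zeta> x = 0"
proof -
  let ?f = "var j :: ('v, 'k) mpoly"
  obtain b where b: "c = Suc (N + Suc b)" using c by (metis add_Suc_right le_Suc_ex add_2_eq_Suc' add.assoc add_Suc)
  have "J ?f c \<zeta> x + J ?f c (Amul_V (\<zeta> ?f) (pd j)) x = 0" if \<zeta>: "\<zeta> \<in> Der" for \<zeta> x
  proof -
    have *: "J ?f (Suc (Suc (a + b))) (bracket (pd j) \<zeta>) x
      + of_nat (Suc b) *s J ?f (Suc (a + b)) \<zeta> x
      - of_nat (Suc a) *s J ?f (Suc (a + b)) (Amul_V (\<zeta> ?f) (pd j)) x = 0"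
      if "Suc a \<ge> N" for a b
      using J_commutator[OF pd_Der \<zeta>, of ?f a j b x] that lin_0[OF lin_J[OF \<zeta>]]
      by (simp add: t pd_var Amul_V_def)
    let ?Z = "J ?f c \<zeta> x" and ?W = "J ?f c (Amul_V (\<zeta> ?f) (pd j)) x"
    let ?P = "J ?f (Suc c) (bracket (pd j) \<zeta>) x"
    \<comment> \<open>Both splittings have total index \<open>c\<close>. Subtraction cancels
      \<open>?P\<close> and leaves \<open>?Z + ?W = 0\<close>.\<close>
    have "(?P + of_nat (Suc (Suc b)) *s ?Z - of_nat (Suc N) *s ?W)
        - (?P + of_nat (Suc b) *s ?Z - of_nat (Suc (Suc N)) *s ?W) = 0"
      using *[of N "Suc b"] *[of "Suc N" b] by (simp add: b)
    moreover have "p + (z + q) - w - (p + q - (z' + w)) = z + z'" for p q w z z' :: 'm by simp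
    ultimately show ?thesis
      by (simp only: of_nat_Suc[of "Suc b"] of_nat_Suc[of "Suc N"] scale_left_distrib scale_one)
  qed
  note main = this
  \<comment> \<open>For this field the two operators in the relation coincide, so twice its
    difference vanishes. That difference is the second operator in the relation for \<zeta>.\<close>
  define \<xi> where "\<xi> = Amul_V (\<zeta> ?f) (pd j)"
  have \<xi>: "\<xi> \<in> Der" by (simp add: \<xi>_def Der_Amul pd_Der)
  have "Amul_V (\<xi> ?f) (pd j) = \<xi>" by (simp add: \<xi>_def Amul_V_def pd_var)
  with main[OF \<xi>] have "(2::'k) *s J ?f c \<xi> x = 0"
    using scale_left_distrib[of 1 1 "J ?f c \<xi> x"] by simp
  then have "J ?f c \<xi> x = 0" by simp
  then show ?thesis using main[OF \<zeta>, of x] by (simp add: \<xi>_def)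
qed

end

section \<open>Growth and differential operators\<close>

text \<open>The lower bound means growth of order at least \<open>n + 1/2\<close>; the square keeps
  the exponent integral. The upper bound is tested at \<open>n + 1/4\<close>, strictly in
  between.\<close>

lemma growth_contradiction:
  fixes f :: "nat \<Rightarrow> nat"
  assumes lim: "limsup (\<lambda>m. ereal (ln (real (f m)) / ln (real m))) \<le> ereal (real n)"
    and K: "K > 0" and f: "\<And>m. m \<ge> 1 \<Longrightarrow> m ^ (2 * n + 1) \<le> (f (K * m))\<^sup>2"
  shows False
proof -
  have "limsup (\<lambda>m. ereal (ln (real (f m)) / ln (real m))) < ereal (real n + 1 / 4)"
    using lim by (rule order.strict_trans1) simp
  then have "eventually (\<lambda>m. ereal (ln (real (f m)) / ln (real m)) < ereal (real n + 1 / 4)) sequentially"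
    by (rule Limsup_lessD)
  then obtain M where M: "\<And>m. m \<ge> M \<Longrightarrow> ln (real (f m)) / ln (real m) < real n + 1 / 4"
    by (auto simp: eventually_sequentially)
  \<comment> \<open>Large enough that \<open>m\<close> is at least \<open>K^(4n+1)\<close>, beyond
    which the dilation of the argument by \<open>K\<close> cannot make up the gap of
    \<open>1/4\<close> in the exponents.\<close>
  define m where "m = nat \<lceil>exp ((4 * real n + 1) * ln (real K))\<rceil> + 2 + M"
  have m: "m \<ge> 2" "m \<ge> M" by (auto simp: m_def)
  have "exp ((4 * real n + 1) * ln (real K)) \<le> real m"
    unfolding m_def by linarith
  then have big: "(4 * real n + 1) * ln (real K) \<le> ln (real m)"
    using m by (subst ln_ge_iff) auto
  have Km: "K * m \<ge> m" "K * m \<ge> 2" using K m by (auto intro: order_trans[of 2 m])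
  have "m ^ (2 * n + 1) \<le> (f (K * m))\<^sup>2" using f m by simp
  then have sq: "real m ^ (2 * n + 1) \<le> (real (f (K * m)))\<^sup>2"
    by (metis of_nat_le_iff of_nat_power)
  moreover have "real m ^ (2 * n + 1) > 0" using m by simp
  ultimately have pos: "real (f (K * m)) > 0"
    by (cases "f (K * m) = 0") auto
  have "ln (real m ^ (2 * n + 1)) \<le> ln ((real (f (K * m)))\<^sup>2)"
    using sq m pos by (subst ln_le_cancel_iff) auto
  moreover have "ln (real m ^ (2 * n + 1)) = real (2 * n + 1) * ln (real m)"
    "ln ((real (f (K * m)))\<^sup>2) = real 2 * ln (real (f (K * m)))"
    by (rule ln_realpow; use m pos in simp)+
  ultimately have 1: "(2 * real n + 1) * ln (real m) \<le> 2 * ln (real (f (K * m)))"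
    by (simp add: algebra_simps)
  have "real (K * m) > 1" using Km by linarith
  then have "ln (real (K * m)) > 0" by (rule ln_gt_zero)
  then have "ln (real (f (K * m))) < (real n + 1 / 4) * ln (real (K * m))"
    using M[of "K * m"] Km m by (simp add: pos_divide_less_eq)
  also have "ln (real (K * m)) = ln (real K) + ln (real m)"
    using K m by (simp add: ln_mult)
  finally have "(2 * real n + 1) * ln (real m) < 2 * ((real n + 1 / 4) * (ln (real K) + ln (real m)))"
    using 1 by linarith
  then have "ln (real m) < (4 * real n + 1) * ln (real K)" by (simp add: algebra_simps)
  with big show False by simp
qed

section \<open>Closure properties of \<open>Diff\<close> and reduction to the variables\<close>

context AV
begin

lemma Hom_cong:
  assumes "Hom_V_End actA D" "\<And>\<eta> x. \<eta> \<in> Der \<Longrightarrow> D' \<eta> x = D \<eta> x"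
  shows "Hom_V_End actA D'"
proof -
  have "(\<lambda>g. const c * \<eta> g) \<in> Der" if "\<eta> \<in> Der" for c and \<eta> :: "('v, 'k) mpoly \<Rightarrow> ('v, 'k) mpoly"
    using Der_Amul[OF that, of "const c"] by (simp add: Amul_V_def)
  then show ?thesis using assms by (auto simp: Hom_V_End_def Der_plus)
qed

text \<open>Only values on \<open>Der\<close> matter. This is needed because additivity of
  \<open>D\<close>, and the identities derived from it, are available only for derivations, whereas
  \<open>D\<close> is defined on all functions.\<close>

lemma Diff_cong:
  assumes "D \<in> Diff actA s" "\<And>\<eta> x. \<eta> \<in> Der \<Longrightarrow> D' \<eta> x = D \<eta> x"
  shows "D' \<in> Diff actA s"
  using assms
proof (induction s arbitrary: D D')
  case 0
  then show ?case using Hom_cong[of D D'] by (simp add: delta_def Der_Amul)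
next
  case (Suc s)
  have "delta actA f D' \<in> Diff actA s" for f
    by (rule Suc.IH[of "delta actA f D"]) (use Suc.prems in \<open>auto simp: delta_def Der_Amul\<close>)
  then show ?case using Hom_cong[of D D'] Suc.prems by auto
qed

lemma Diff_plus:
  "D \<in> Diff actA s \<Longrightarrow> D' \<in> Diff actA s \<Longrightarrow> (\<lambda>\<eta> x. D \<eta> x + D' \<eta> x) \<in> Diff actA s"
proof (induction s arbitrary: D D')
  case 0
  then show ?case
    by (auto simp: Hom_V_End_def delta_def A_add scale_right_distrib algebra_simps)
next
  case (Suc s)
  have "delta actA f (\<lambda>\<eta> x. D \<eta> x + D' \<eta> x) = (\<lambda>\<eta> x. delta actA f D \<eta> x + delta actA f D' \<eta> x)" for f
    by (simp add: delta_def A_add algebra_simps)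
  moreover have "Hom_V_End actA (\<lambda>\<eta> x. D \<eta> x + D' \<eta> x)"
    using Suc.prems by (auto simp: Hom_V_End_def scale_right_distrib algebra_simps)
  ultimately show ?case using Suc by simp
qed

lemma Diff_A: "D \<in> Diff actA s \<Longrightarrow> (\<lambda>\<eta> x. actA g (D \<eta> x)) \<in> Diff actA s"
proof (induction s arbitrary: D)
  case 0
  have "delta actA f (\<lambda>\<eta> x. actA g (D \<eta> x)) = (\<lambda>\<eta> x. actA g (delta actA f D \<eta> x))" for f
    by (simp add: delta_def A_diff A_comm[of f g])
  with 0 show ?case by (auto simp: Hom_V_End_def A_add A_scale A_zero)
next
  case (Suc s)
  have "delta actA f (\<lambda>\<eta> x. actA g (D \<eta> x)) = (\<lambda>\<eta> x. actA g (delta actA f D \<eta> x))" for f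
    by (simp add: delta_def A_diff A_comm[of f g])
  moreover have "Hom_V_End actA (\<lambda>\<eta> x. actA g (D \<eta> x))"
    using Suc.prems by (auto simp: Hom_V_End_def A_add A_scale)
  ultimately show ?case using Suc by simp
qed

lemma Hom_Amul: "Hom_V_End actA D \<Longrightarrow> Hom_V_End actA (\<lambda>\<eta>. D (Amul_V g \<eta>))"
  using Hom_delta[of D g]
  unfolding Hom_V_End_def delta_def
  by (simp add: Der_Amul A_add A_scale scale_right_diff_distrib)

lemma Diff_Amul: "D \<in> Diff actA s \<Longrightarrow> (\<lambda>\<eta>. D (Amul_V g \<eta>)) \<in> Diff actA s"
proof (induction s arbitrary: D)
  case 0
  have "delta actA f (\<lambda>\<eta>. D (Amul_V g \<eta>)) = (\<lambda>\<eta>. delta actA f D (Amul_V g \<eta>))" for f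
    by (simp add: delta_def Amul_Amul[of f g])
  with 0 show ?case by (simp add: Hom_Amul Der_Amul)
next
  case (Suc s)
  have "delta actA f (\<lambda>\<eta>. D (Amul_V g \<eta>)) = (\<lambda>\<eta>. delta actA f D (Amul_V g \<eta>))" for f
    by (simp add: delta_def Amul_Amul[of f g])
  with Suc show ?case by (simp add: Hom_Amul)
qed

lemma zero_Diff:
  assumes "Hom_V_End actA D" "\<And>\<eta> x. \<eta> \<in> Der \<Longrightarrow> D \<eta> x = 0"
  shows "D \<in> Diff actA s"
  using assms
proof (induction s arbitrary: D)
  case (Suc s)
  have "delta actA f D \<in> Diff actA s" for f
    by (rule Suc.IH[OF Hom_delta[OF Suc.prems(1)]]) (simp add: delta_def Suc.prems(2) Der_Amul A_zero)
  then show ?case using Suc.prems(1) by simp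
qed (simp add: delta_def Der_Amul A_zero)

text \<open>The differences by constants vanish, those by sums add up, and the difference by
  \<open>f * g\<close> is the difference by \<open>f\<close> after multiplication of the argument by
  \<open>g\<close>, plus \<open>f\<close> times the difference by \<open>g\<close>.
  \<open>Diff\<close> is closed under all these operations.\<close>

lemma delta_in_Diff:
  assumes D: "Hom_V_End actA D" and "\<And>j. delta actA (var j) D \<in> Diff actA s"
  shows "delta actA f D \<in> Diff actA s"
proof (induction f rule: mpoly_induct)
  case (const c)
  show ?case
    by (rule zero_Diff) (use D in \<open>simp_all add: Hom_delta\<close>,
      use Hom_cmult[OF D] in \<open>simp add: delta_def Amul_V_def A_const\<close>)
next
  case (add f g)
  show ?case
  proof (rule Diff_cong[OF Diff_plus[OF add]])
    fix \<eta> x assume \<eta>: "(\<eta> :: ('v, 'k) mpoly \<Rightarrow> ('v, 'k) mpoly) \<in> Der"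
    have "Amul_V (f + g) \<eta> = (\<lambda>h. Amul_V f \<eta> h + Amul_V g \<eta> h)"
      by (simp add: Amul_V_def distrib_right)
    then show "delta actA (f + g) D \<eta> x = delta actA f D \<eta> x + delta actA g D \<eta> x"
      using Hom_plus[OF D Der_Amul[OF \<eta>] Der_Amul[OF \<eta>]] by (simp add: delta_def A_plus)
  qed
next
  case (mult f g)
  have "delta actA (f * g) D = (\<lambda>\<eta> x. delta actA f D (Amul_V g \<eta>) x + actA f (delta actA g D \<eta> x))"
  proof (intro ext)
    fix \<eta> x
    have "Amul_V (f * g) \<eta> = Amul_V f (Amul_V g \<eta>)" by (simp add: Amul_V_def ac_simps)
    then show "delta actA (f * g) D \<eta> x = delta actA f D (Amul_V g \<eta>) x + actA f (delta actA g D \<eta> x)"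
      by (simp add: delta_def A_mult A_diff)
  qed
  then show ?case using mult by (simp add: Diff_plus Diff_A Diff_Amul)
qed (use assms in auto)

lemma delta_comm: "delta actA f (delta actA g D) = delta actA g (delta actA f D)"
  by (simp add: delta_def fun_eq_iff A_diff A_comm[of f g] Amul_Amul[of f g])

text \<open>The differences by the variables commute, so taking one of them lowers its own
  nilpotency exponent by one and keeps the others. Induction on the sum of the exponents then
  applies.\<close>

lemma Diff_if_delta_nilpotent:
  assumes "Hom_V_End actA D" "\<And>j \<eta> x. \<eta> \<in> Der \<Longrightarrow> (delta actA (var j) ^^ k j) D \<eta> x = 0"
  shows "D \<in> Diff actA (\<Sum>j\<in>UNIV. k j)"
  using assms
proof (induction "\<Sum>j\<in>UNIV. k j" arbitrary: D k)
  case 0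
  \<comment> \<open>All exponents are zero; \<open>undefined\<close> stands for an arbitrary
    variable. A zeroth power that vanishes says that \<open>D\<close> itself is zero on
    \<open>Der\<close>.\<close>
  then have "k undefined = 0" by simp
  then show ?case using 0 zero_Diff[of D] by (metis funpow_0)
next
  case (Suc s)
  show ?case
  proof (cases "\<exists>j. k j = 0")
    case True
    then show ?thesis using Suc.prems zero_Diff[of D] by (metis funpow_0)
  next
    case False
    have "delta actA (var i) D \<in> Diff actA s" for i
    proof -
      define k' where "k' = k(i := k i - 1)"
      have ki: "k i = Suc (k' i)" using False[simplified, rule_format, of i] by (simp add: k'_def)
      have "sum k UNIV = Suc (sum k' UNIV)"
      proof -
        have "sum k UNIV = k i + sum k (UNIV - {i})" "sum k' UNIV = k' i + sum k' (UNIV - {i})"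
          by (rule sum.remove; simp)+
        moreover have "sum k' (UNIV - {i}) = sum k (UNIV - {i})" by (intro sum.cong) (auto simp: k'_def)
        ultimately show ?thesis using ki by simp
      qed
      then have s: "s = sum k' UNIV" using Suc.hyps(2) by simp
      have "(delta actA (var j) ^^ k' j) (delta actA (var i) D) \<eta> x = 0" if "\<eta> \<in> Der" for j \<eta> x
      proof (cases "j = i")
        case True
        have "(delta actA (var i) ^^ k i) D \<eta> x = 0" by (rule Suc.prems(2)[OF that])
        then show ?thesis unfolding True ki by (simp add: funpow_swap1)
      next
        case False
        have "(delta actA (var j) ^^ n) (delta actA (var i) D) = delta actA (var i) ((delta actA (var j) ^^ n) D)" for n
          by (induction n) (simp_all add: delta_comm[of "var j" "var i"])
        moreover have "(delta actA (var j) ^^ k j) D \<eta>' y = 0" if "\<eta>' \<in> Der" for \<eta>' y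
          by (rule Suc.prems(2)[OF that])
        ultimately show ?thesis using False that by (simp add: k'_def delta_def Der_Amul A_zero)
      qed
      then show ?thesis
        unfolding s by (intro Suc.hyps(1)[OF s] Hom_delta Suc.prems(1))
    qed
    from delta_in_Diff[OF Suc.prems(1) this] show ?thesis
      using Suc.prems(1) by (simp flip: Suc.hyps(2))
  qed
qed

end

section \<open>A finite-dimensional generating subspace\<close>

context AV
begin

lemma mspan_eq_span: "mspan actA S = span S"
proof
  show "mspan actA S \<subseteq> span S"
  proof
    fix x assume "x \<in> mspan actA S"
    then show "x \<in> span S"
      by induction (auto intro: span_zero span_base span_add span_scale)
  qed
  show "span S \<subseteq> mspan actA S"
    by (rule span_minimal) (auto simp: subspace_def intro: mspan.intros)
qed

text \<open>A finite set, closed under lowering exponents. With exponents up to 3 present, raising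
  an exponent further by \<open>bracket_raise\<close> has a nonzero factor, so all other fields are
  reached.\<close>

definition gen_fields :: "(('v, 'k) mpoly \<Rightarrow> ('v, 'k) mpoly) set" where
  "gen_fields = {Amul_V (mon \<gamma>) (pd i) | \<gamma> i. \<forall>k. Poly_Mapping.lookup \<gamma> k \<le> 3}"

definition gen_ops :: "('m \<Rightarrow> 'm) set" where
  "gen_ops = insert id (range (\<lambda>j. actA (var j)) \<union> actV ` gen_fields)"

lemma finite_gen_ops: "finite gen_ops"
proof -
  let ?S = "{\<gamma> :: 'v \<Rightarrow>\<^sub>0 nat. \<forall>k. Poly_Mapping.lookup \<gamma> k \<le> 3}"
  have "finite (Poly_Mapping.lookup ` ?S)"
    by (rule finite_subset[OF _ finite_set_of_finite_funs[of UNIV "{..3}" 0]]) auto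
  then have "finite ?S" by (rule finite_imageD) (simp add: inj_on_def lookup_inject)
  then have "finite ((\<lambda>(\<gamma>, i). Amul_V (mon \<gamma>) (pd i)) ` (?S \<times> UNIV) :: (('v, 'k) mpoly \<Rightarrow> ('v, 'k) mpoly) set)"
    by simp
  then have "finite gen_fields"
    by (rule rev_finite_subset) (auto simp: gen_fields_def)
  then show ?thesis by (simp add: gen_ops_def)
qed

lemma gen_fields_Der: "gen_fields \<subseteq> Der"
  by (auto simp: gen_fields_def intro!: Der_Amul pd_Der)

lemma lin_gen_ops: "T \<in> gen_ops \<Longrightarrow> lin T"
  using gen_fields_Der by (auto simp: gen_ops_def lin_A lin_V) (simp add: lin_def)

definition gen_space :: "('m \<Rightarrow> 'm) set" where
  "gen_space = opspan actA gen_ops"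

lemma gen_ops_space: "T \<in> gen_ops \<Longrightarrow> T \<in> gen_space"
  by (simp add: gen_space_def opspan.base)

lemma gen_space_lin: "T \<in> gen_space \<Longrightarrow> lin T"
  unfolding gen_space_def
proof (induction rule: opspan.induct)
  case (base T)
  then show ?case by (rule lin_gen_ops)
qed (auto simp: lin_def algebra_simps)

lemma gen_ops_alg: "gen_ops \<subseteq> act_alg actA actV"
  using gen_fields_Der by (auto simp: gen_ops_def act_alg_def intro: subalg.intros)

lemma subalg_zero: "(\<lambda>x. 0) \<in> subalg actA S"
proof -
  have "(\<lambda>x. 0 *s id x) \<in> subalg actA S" by (intro subalg.intros)
  then show ?thesis by (simp only: scale_zero_left)
qed

lemma gen_space_alg: "gen_space \<subseteq> act_alg actA actV"
proof
  fix T assume "T \<in> gen_space"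
  then show "T \<in> act_alg actA actV" unfolding gen_space_def
  proof (induction rule: opspan.induct)
    case (base T)
    then show ?case using gen_ops_alg by blast
  qed (auto simp: act_alg_def subalg_zero intro: subalg.intros)
qed

lemma subalg_diff: "T \<in> subalg actA S \<Longrightarrow> U \<in> subalg actA S \<Longrightarrow> (\<lambda>x. T x - U x) \<in> subalg actA S"
proof -
  assume T: "T \<in> subalg actA S" "U \<in> subalg actA S"
  have "(\<lambda>x. T x + (- 1) *s U x) \<in> subalg actA S" by (intro subalg.intros T)
  then show ?thesis by simp
qed

lemma subalg_gen_A: "actA f \<in> subalg actA gen_space"
proof (induction f rule: mpoly_induct)
  case (const c)
  have "actA (const c) = (\<lambda>x. c *s id x)" by (simp add: fun_eq_iff A_const)
  then show ?case using subalg.scal[OF subalg.one] by metis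
next
  case (var j)
  show ?case by (intro subalg.base gen_ops_space) (simp add: gen_ops_def)
next
  case (add f g)
  have "actA (f + g) = (\<lambda>x. actA f x + actA g x)" by (simp add: fun_eq_iff A_plus)
  then show ?case using subalg.add[OF add] by simp
next
  case (mult f g)
  have "actA (f * g) = actA f \<circ> actA g" by (simp add: fun_eq_iff A_mult)
  then show ?case using subalg.comp[OF mult] by metis
qed

lemma subalg_gen_scale:
  assumes "\<eta> \<in> Der" "actV \<eta> \<in> subalg actA gen_space"
  shows "actV (\<lambda>g. const c * \<eta> g) \<in> subalg actA gen_space"
proof -
  have "actV (\<lambda>g. const c * \<eta> g) = (\<lambda>x. c *s actV \<eta> x)"
    using assms(1) by (simp add: fun_eq_iff V_cmult)
  then show ?thesis using subalg.scal[OF assms(2)] by simp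
qed

text \<open>Bracketing with \<open>x_k^2 d_k\<close> raises the exponent of \<open>x_k\<close>, with a nonzero factor as soon as
  that exponent is at least three.\<close>

lemma subalg_gen_mon: "actV (Amul_V (mon \<gamma>) (pd i)) \<in> subalg actA gen_space"
proof (induction "\<Sum>k\<in>UNIV. Poly_Mapping.lookup \<gamma> k" arbitrary: \<gamma> rule: less_induct)
  case less
  show ?case
  proof (cases "\<forall>k. Poly_Mapping.lookup \<gamma> k \<le> 3")
    case True
    then have "Amul_V (mon \<gamma>) (pd i) \<in> gen_fields" by (auto simp: gen_fields_def)
    then show ?thesis by (intro subalg.base gen_ops_space) (simp add: gen_ops_def)
  next
    case False
    then obtain k where "\<not> Poly_Mapping.lookup \<gamma> k \<le> 3" by blast
    then have k: "Poly_Mapping.lookup \<gamma> k \<ge> 4" by simp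
    define \<gamma>' where "\<gamma>' = \<gamma> - Poly_Mapping.single k 1"
    have \<gamma>: "\<gamma> = \<gamma>' + Poly_Mapping.single k 1"
      using k by (intro poly_mapping_eqI) (auto simp: \<gamma>'_def lookup_add lookup_minus lookup_single when_def)
    have k': "Poly_Mapping.lookup \<gamma>' k \<ge> 3" using k by (simp add: \<gamma>'_def lookup_minus)
    have "(\<Sum>k\<in>UNIV. Poly_Mapping.lookup \<gamma>' k) < (\<Sum>k\<in>UNIV. Poly_Mapping.lookup \<gamma> k)"
      using k by (intro sum_strict_mono_ex1) (auto simp: \<gamma>'_def lookup_minus intro!: exI[of _ k])
    then have IH: "actV (Amul_V (mon \<gamma>') (pd i)) \<in> subalg actA gen_space" by (rule less)
    let ?q = "Amul_V (mon (Poly_Mapping.single k 2)) (pd k) :: ('v, 'k) mpoly \<Rightarrow> ('v, 'k) mpoly"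
    have "?q \<in> gen_fields"
      by (auto simp: gen_fields_def lookup_single when_def intro!: exI[of _ "Poly_Mapping.single k 2"])
    then have q: "actV ?q \<in> subalg actA gen_space"
      by (intro subalg.base gen_ops_space) (simp add: gen_ops_def)
    define r :: 'k where "r = of_nat (Poly_Mapping.lookup \<gamma>' k - (if i = k then 2 else 0))"
    have "r \<noteq> 0" using k' unfolding r_def of_nat_eq_0_iff by auto
    let ?T = "actV (Amul_V (mon \<gamma>) (pd i))"
    have D: "?q \<in> Der" "Amul_V (mon \<gamma>') (pd i) \<in> Der" "Amul_V (mon \<gamma>) (pd i) \<in> Der"
      by (intro Der_Amul pd_Der)+
    have "bracket ?q (Amul_V (mon \<gamma>') (pd i)) = (\<lambda>g. const r * Amul_V (mon \<gamma>) (pd i) g)"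
      using bracket_raise[where k = k and \<gamma> = \<gamma>' and i = i and ?'k = 'k] k' by (simp add: r_def \<gamma> Amul_V_def ac_simps)
    then have "r *s ?T x = actV ?q (actV (Amul_V (mon \<gamma>') (pd i)) x)
        - actV (Amul_V (mon \<gamma>') (pd i)) (actV ?q x)" for x
      using V_bracket[OF D(1,2), of x] V_cmult[OF D(3), of r x] by simp
    moreover have "?T x = inverse r *s (r *s ?T x)" for x using \<open>r \<noteq> 0\<close> by simp
    ultimately have "?T = (\<lambda>x. inverse r *s ((actV ?q \<circ> actV (Amul_V (mon \<gamma>') (pd i))) x
        - (actV (Amul_V (mon \<gamma>') (pd i)) \<circ> actV ?q) x))"
      by (metis comp_apply)
    then show ?thesis
      using subalg.scal[OF subalg_diff[OF subalg.comp[OF q IH] subalg.comp[OF IH q]], of "inverse r"]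
      by simp
  qed
qed

lemma subalg_gen_plus:
  assumes "\<eta> \<in> Der" "\<xi> \<in> Der" "actV \<eta> \<in> subalg actA gen_space" "actV \<xi> \<in> subalg actA gen_space"
  shows "actV (\<lambda>g. \<eta> g + \<xi> g) \<in> subalg actA gen_space"
proof -
  have "actV (\<lambda>g. \<eta> g + \<xi> g) = (\<lambda>x. actV \<eta> x + actV \<xi> x)"
    using assms by (simp add: fun_eq_iff V_plus)
  then show ?thesis using subalg.add[OF assms(3,4)] by simp
qed

lemma subalg_gen_V:
  assumes "\<eta> \<in> Der"
  shows "actV \<eta> \<in> subalg actA gen_space"
proof -
  have 1: "actV (Amul_V f (pd i)) \<in> subalg actA gen_space" for f i
  proof (induction f rule: poly_mapping_single_induct)
    case (1 \<gamma> c)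
    have "Amul_V (Poly_Mapping.single \<gamma> c) (pd i) = (\<lambda>g. const c * Amul_V (mon \<gamma>) (pd i) g)"
      by (simp add: Amul_V_def const_mult_single flip: mult.assoc)
    then show ?case using subalg_gen_scale[OF Der_Amul[OF pd_Der] subalg_gen_mon] by simp
  next
    case (2 f g)
    have "Amul_V (f + g) (pd i) = (\<lambda>h. Amul_V f (pd i) h + Amul_V g (pd i) h)"
      by (simp add: Amul_V_def distrib_right)
    then show ?case using subalg_gen_plus[OF Der_Amul[OF pd_Der] Der_Amul[OF pd_Der] 2] by simp
  qed
  have "actV (\<lambda>g. \<Sum>i\<in>I. Amul_V (\<eta> (var i)) (pd i) g) \<in> subalg actA gen_space" if "finite I" for I
    using that
  proof (induction I rule: finite_induct)
    case empty
    have "actV (\<lambda>g. 0) = (\<lambda>x. 0)" by (simp add: fun_eq_iff Hom_zero[OF Hom_V])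
    then show ?case by (simp add: subalg_zero)
  next
    case (insert i I)
    then show ?case
      using subalg_gen_plus[OF Der_Amul[OF pd_Der] sum_Der 1 insert.IH] by (simp add: Der_Amul pd_Der)
  qed
  from this[of UNIV] show ?thesis using Der_expand[OF assms] by simp
qed

lemma subalg_gen_eq: "subalg actA gen_space = act_alg actA actV"
proof
  show "subalg actA gen_space \<subseteq> act_alg actA actV"
  proof
    fix T assume "T \<in> subalg actA gen_space"
    then show "T \<in> act_alg actA actV" unfolding act_alg_def
    proof (induction rule: subalg.induct)
      case (base T)
      then show ?case using gen_space_alg by (auto simp: act_alg_def)
    qed (blast intro: subalg.intros)+
  qed
  show "act_alg actA actV \<subseteq> subalg actA gen_space"
  proof
    fix T assume "T \<in> act_alg actA actV"
    then show "T \<in> subalg actA gen_space" unfolding act_alg_def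
    proof (induction rule: subalg.induct)
      case (base T)
      then show ?case using subalg_gen_A subalg_gen_V by blast
    qed (blast intro: subalg.intros)+
  qed
qed

lemma gen_space_generates: "gen_alg_subspace actA actV gen_space"
proof -
  have "id \<in> gen_space" by (rule gen_ops_space) (simp add: gen_ops_def)
  moreover have "fd_opsubspace actA gen_space"
    unfolding fd_opsubspace_def gen_space_def using finite_gen_ops by blast
  ultimately show ?thesis
    using gen_space_alg subalg_gen_eq by (simp add: gen_alg_subspace_def)
qed

text \<open>Reduces invariance under the whole acting algebra to the finitely many
  generators.\<close>

lemma subalg_gen_invariant:
  assumes "T \<in> act_alg actA actV" "subspace W" "\<And>S x. S \<in> gen_ops \<Longrightarrow> x \<in> W \<Longrightarrow> S x \<in> W" "x \<in> W"
  shows "T x \<in> W"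
proof -
  have 1: "S x \<in> W" if "S \<in> gen_space" "x \<in> W" for S x
    using that unfolding gen_space_def
    by (induction rule: opspan.induct)
      (auto simp: assms(3) intro: subspace_0 subspace_add subspace_scale assms(2))
  from assms(1) have "T \<in> subalg actA gen_space" by (simp add: subalg_gen_eq)
  then show ?thesis using assms(4)
    by (induction arbitrary: x rule: subalg.induct)
      (auto simp: 1 intro: subspace_add subspace_scale assms(2))
qed

text \<open>The submodule generated by \<open>S\<close> over the Weyl algebra of \<open>A\<close>
  and the partial derivatives. Scalars are covered by the constants in \<open>A\<close>.\<close>

inductive_set weyl_closure :: "'m set \<Rightarrow> 'm set" for S where
  zero: "0 \<in> weyl_closure S"
| base: "x \<in> S \<Longrightarrow> x \<in> weyl_closure S"
| add: "x \<in> weyl_closure S \<Longrightarrow> y \<in> weyl_closure S \<Longrightarrow> x + y \<in> weyl_closure S"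
| A: "x \<in> weyl_closure S \<Longrightarrow> actA f x \<in> weyl_closure S"
| Y: "x \<in> weyl_closure S \<Longrightarrow> actV (pd j) x \<in> weyl_closure S"

lemma subspace_weyl_closure: "subspace (weyl_closure S)"
  by (auto simp: subspace_def intro: weyl_closure.intros simp flip: A_const)

lemma weyl_closure_minimal: "S \<subseteq> weyl_closure S' \<Longrightarrow> weyl_closure S \<subseteq> weyl_closure S'"
proof
  fix x assume S: "S \<subseteq> weyl_closure S'" and "x \<in> weyl_closure S"
  from this(2) show "x \<in> weyl_closure S'"
    using S by induction (auto intro: weyl_closure.intros)
qed

end

text \<open>Each variable contributes both orders of its pair, so words in the first members, as
  well as words in the second members, are monomials in all \<open>x_j\<close> and
  \<open>d_j\<close>.\<close>

primrec xd_pairs :: "('a \<Rightarrow> 'b \<Rightarrow> 'b) \<Rightarrow> ('a \<Rightarrow> 'b \<Rightarrow> 'b) \<Rightarrow> 'a list \<Rightarrow> (('b \<Rightarrow> 'b) \<times> ('b \<Rightarrow> 'b)) list" where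
  "xd_pairs X Y [] = []"
| "xd_pairs X Y (j # js) = (X j, Y j) # (Y j, X j) # xd_pairs X Y js"

lemma length_xd_pairs: "length (xd_pairs X Y js) = 2 * length js"
  by (induction js) auto

lemma set_xd_pairs: "set (xd_pairs X Y js) = (\<Union>j\<in>set js. {(X j, Y j), (Y j, X j)})"
  by (induction js) auto

section \<open>Coordinates and partial derivatives as Weyl pairs\<close>

context AV
begin

abbreviation "X j \<equiv> actA (var j)"
abbreviation "Y j \<equiv> actV (pd j)"

lemma YX: "Y i (X j x) = X j (Y i x) + (if i = j then x else 0)"
  by (simp add: V_A[OF pd_Der] pd_var A_1 A_0)

lemma YY: "Y i (Y j x) = Y j (Y i x)"
  using V_bracket[OF pd_Der pd_Der, of i j x] by (simp add: pd_commute Hom_zero[OF Hom_V])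

lemma weyl_pairs_xd: "distinct js \<Longrightarrow> weyl_pairs (xd_pairs X Y js)"
proof (induction js)
  case (Cons j js)
  have "\<exists>c. c \<noteq> 0 \<and> (\<forall>x. Y j (X j x) = X j (Y j x) + c *s x)"
    by (rule exI[of _ 1]) (simp add: YX)
  moreover have "\<exists>c. c \<noteq> 0 \<and> (\<forall>x. X j (Y j x) = Y j (X j x) + c *s x)"
    by (rule exI[of _ "-1"]) (simp add: YX)
  ultimately show ?case using Cons
    by (auto simp: set_xd_pairs lin_A lin_V[OF pd_Der] YX YY A_comm[of "var j"])
qed simp

end

section \<open>Finite generation over the Weyl algebra\<close>

locale AV_generated = AV actA actV
  for actA :: "('v::finite, 'k::field_char_0) mpoly \<Rightarrow> 'm::ab_group_add \<Rightarrow> 'm" and actV +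
  fixes M0 :: "'m set"
  assumes M0: "gen_mod_subspace actA actV M0"
begin

definition G :: "nat \<Rightarrow> 'm set" where
  "G m = powmod actA gen_space m M0"

lemma G_span: "G m = span {T x | T x. T \<in> comps gen_space m \<and> x \<in> M0}"
  by (simp add: G_def powmod_def mspan_eq_span)

lemma subspace_G: "subspace (G m)"
  by (simp add: G_span)

lemma G_op:
  assumes "T \<in> gen_space" "w \<in> G m"
  shows "T w \<in> G (Suc m)"
proof (rule lin_span[OF gen_space_lin[OF assms(1)] _ subspace_G])
  show "w \<in> span {T x | T x. T \<in> comps gen_space m \<and> x \<in> M0}"
    using assms(2) by (simp add: G_span)
  show "T ` {T x | T x. T \<in> comps gen_space m \<and> x \<in> M0} \<subseteq> G (Suc m)"
  proof
    fix y assume "y \<in> T ` {T x | T x. T \<in> comps gen_space m \<and> x \<in> M0}"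
    then obtain U x where y: "y = (T \<circ> U) x" and U: "U \<in> comps gen_space m" and x: "x \<in> M0" by auto
    have "T \<circ> U \<in> comps gen_space (Suc m)" using assms(1) U by auto
    then show "y \<in> G (Suc m)" unfolding G_span y using x by (intro span_base) blast
  qed
qed

lemma id_gen: "id \<in> gen_space"
  by (rule gen_ops_space) (simp add: gen_ops_def)

lemma G_mono: "m \<le> m' \<Longrightarrow> G m \<subseteq> G m'"
  by (rule lift_Suc_mono_le[of G]) (use G_op[OF id_gen] in auto)

lemma M0_G: "M0 \<subseteq> G 0"
  unfolding G_span by (auto intro!: span_base exI[of _ id])

lemma G_fd: "\<exists>B. finite B \<and> G m \<subseteq> span B"
proof (induction m)
  case 0
  obtain F where F: "finite F" "span F = M0"
    using M0 by (auto simp: gen_mod_subspace_def fd_subspace_def mspan_eq_span)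
  have "G 0 \<subseteq> span M0" unfolding G_span by (rule span_mono) auto
  also have "span M0 = span F" unfolding F(2)[symmetric] by (rule span_span)
  finally show ?case using F by blast
next
  case (Suc m)
  then obtain B where B: "finite B" "G m \<subseteq> span B" by blast
  define B' where "B' = (\<lambda>(T, x). T x) ` (gen_ops \<times> B)"
  have 1: "T y \<in> span B'" if "T \<in> gen_space" "y \<in> span B" for T y
    using that unfolding gen_space_def
  proof (induction rule: opspan.induct)
    case (base T)
    show ?case
    proof (rule lin_span[OF lin_gen_ops[OF base(1)] _ subspace_span base(2)])
      show "T ` B \<subseteq> span B'" using base(1) by (auto simp: B'_def intro!: span_base)
    qed
  qed (auto intro: span_zero span_add span_scale)
  have "G (Suc m) \<subseteq> span B'"
    unfolding G_span[of "Suc m"]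
  proof (rule span_minimal[OF _ subspace_span], rule subsetI)
    fix y assume "y \<in> {T x | T x. T \<in> comps gen_space (Suc m) \<and> x \<in> M0}"
    then obtain S T x where y: "y = S (T x)" "S \<in> gen_space" "T \<in> comps gen_space m" "x \<in> M0" by auto
    have "T x \<in> G m" unfolding G_span using y by (intro span_base) blast
    then show "y \<in> span B'" using 1 B(2) y by auto
  qed
  moreover have "finite B'" using B finite_gen_ops by (simp add: B'_def)
  ultimately show ?case by blast
qed

text \<open>\<open>vdim\<close> is a least element and has meaning only if a finite spanning set
  exists; \<open>G_fd\<close> provides one.\<close>

lemma vdim_G_ge:
  assumes "independent B" "B \<subseteq> G m"
  shows "finite B \<and> card B \<le> vdim actA (G m)"
proof -
  obtain A where A: "A \<subseteq> G m" "independent A" "G m \<subseteq> span A" by (rule maximal_independent_subset)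
  obtain B' where B': "finite B'" "G m \<subseteq> span B'" using G_fd by blast
  have "finite A" using independent_span_bound[OF B'(1) A(2)] A(1) B'(2) by auto
  moreover have "span A = G m" using A span_minimal[OF A(1) subspace_G] by auto
  ultimately have "\<exists>d F. finite F \<and> F \<subseteq> G m \<and> card F = d \<and> mspan actA F = G m"
    using A(1) by (auto simp: mspan_eq_span)
  from LeastI_ex[OF this] obtain F where F: "finite F" "card F = vdim actA (G m)" "span F = G m"
    by (auto simp: vdim_def mspan_eq_span)
  then show ?thesis using independent_span_bound[OF F(1) assms(1)] assms(2) by simp
qed

lemma invariant_UNIV:
  assumes "subspace W" "M0 \<subseteq> W" "\<And>T x. T \<in> gen_ops \<Longrightarrow> x \<in> W \<Longrightarrow> T x \<in> W"
  shows "W = UNIV"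
proof -
  have "span {T x | T x. T \<in> act_alg actA actV \<and> x \<in> M0} \<subseteq> W"
  proof (rule span_minimal[OF _ assms(1)], safe)
    fix T x assume "T \<in> act_alg actA actV" "x \<in> M0"
    then show "T x \<in> W"
      using subalg_gen_invariant[of T W x] assms by blast
  qed
  then show ?thesis using M0 by (auto simp: gen_mod_subspace_def mspan_eq_span)
qed

lemma G_exhausts: "\<exists>m. x \<in> G m"
proof -
  have "(\<Union>m. G m) = UNIV"
  proof (rule invariant_UNIV)
    show "subspace (\<Union>m. G m)"
    proof (unfold subspace_def, intro conjI ballI allI)
      show "0 \<in> (\<Union>m. G m)" using subspace_0[OF subspace_G] by blast
      fix x y assume "x \<in> (\<Union>m. G m)" "y \<in> (\<Union>m. G m)"
      then obtain a b where "x \<in> G a" "y \<in> G b" by blast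
      then have "x \<in> G (max a b)" "y \<in> G (max a b)"
        using G_mono[of a "max a b"] G_mono[of b "max a b"] by auto
      then show "x + y \<in> (\<Union>m. G m)" using subspace_add[OF subspace_G] by blast
    next
      fix x c assume "x \<in> (\<Union>m. G m)"
      then show "c *s x \<in> (\<Union>m. G m)" using subspace_scale[OF subspace_G] by blast
    qed
    show "M0 \<subseteq> (\<Union>m. G m)" using M0_G by blast
    show "T x \<in> (\<Union>m. G m)" if "T \<in> gen_ops" "x \<in> (\<Union>m. G m)" for T x
      using that G_op[OF gen_ops_space] by blast
  qed
  then show ?thesis by blast
qed

lemma X_gen: "X j \<in> gen_ops"
  by (simp add: gen_ops_def)

lemma V_gen: "\<eta> \<in> gen_fields \<Longrightarrow> actV \<eta> \<in> gen_ops"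
  by (simp add: gen_ops_def)

lemma pd_gen: "pd j \<in> gen_fields"
proof -
  have "pd j = Amul_V (mon 0) (pd j)" by (simp add: Amul_V_def)
  then show ?thesis unfolding gen_fields_def by fastforce
qed

lemma euler_gen: "Amul_V (var j) (pd j) \<in> gen_fields"
  by (auto simp: gen_fields_def var_def lookup_single when_def intro!: exI[of _ "Poly_Mapping.single j 1"])

lemma XY_G: "T \<in> fst ` set (xd_pairs X Y js) \<union> snd ` set (xd_pairs X Y js) \<Longrightarrow> w \<in> G m \<Longrightarrow> T w \<in> G (Suc m)"
  by (rule G_op[OF gen_ops_space]) (auto simp: set_xd_pairs X_gen V_gen pd_gen)

lemma funpow_G: "(\<And>m w. w \<in> G m \<Longrightarrow> T w \<in> G (m + k)) \<Longrightarrow> w \<in> G m \<Longrightarrow> (T ^^ a) w \<in> G (m + k * a)"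
proof (induction a)
  case (Suc a)
  then have "T ((T ^^ a) w) \<in> G (m + k * a + k)" by blast
  then show ?case by (simp add: add_ac)
qed simp

text \<open>Every exponent is below \<open>m\<close>, so each letter raises the filtration degree by
  at most \<open>m\<close>.\<close>

lemma word_G:
  assumes "\<And>T m w. T \<in> set Ps \<Longrightarrow> w \<in> G m \<Longrightarrow> T w \<in> G (Suc m)" "as \<in> box (length Ps) m" "w \<in> G r"
  shows "word Ps as w \<in> G (r + length Ps * m)"
  using assms(1,2)
proof (induction Ps arbitrary: as)
  case Nil
  then show ?case using assms(3) by simp
next
  case (Cons P Ps)
  obtain a as' where as: "as = a # as'" "a < m" "as' \<in> box (length Ps) m"
    using Cons.prems(2) by (cases as) auto
  have "word Ps as' w \<in> G (r + length Ps * m)" using Cons as by simp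
  then have "(P ^^ a) (word Ps as' w) \<in> G (r + length Ps * m + 1 * a)"
    by (rule funpow_G[rotated]) (use Cons.prems(1)[of P] in simp)
  also have "\<dots> \<subseteq> G (r + length (P # Ps) * m)" using as(2) by (intro G_mono) simp
  finally show ?case by (simp add: as)
qed

lemma word_in: "(\<And>T w. T \<in> set Ps \<Longrightarrow> w \<in> W \<Longrightarrow> T w \<in> W) \<Longrightarrow> w \<in> W \<Longrightarrow> word Ps as w \<in> W"
proof (induction Ps arbitrary: as)
  case (Cons P Ps)
  have "word Ps (tl as) w \<in> W" using Cons by simp
  then show ?case using funpow_in[of W P] Cons.prems(1)[of P] by simp
qed simp

text \<open>The abstract bound for the \<open>2n\<close> pairs of the Weyl algebra. The words in
  second and first members cost \<open>2nm\<close> filtration degrees each and the powers of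
  \<open>E\<close> at most \<open>2L\<close>. All vectors stay in \<open>W\<close>, so only
  dimensions inside \<open>W\<close> enter.\<close>

lemma bernstein_G:
  assumes N: "subspace N" "\<And>f x. x \<in> N \<Longrightarrow> actA f x \<in> N" "\<And>j x. x \<in> N \<Longrightarrow> Y j x \<in> N" "\<And>x. x \<in> N \<Longrightarrow> E x \<in> N"
    and W: "\<And>f x. x \<in> W \<Longrightarrow> actA f x \<in> W" "\<And>j x. x \<in> W \<Longrightarrow> Y j x \<in> W" "\<And>x. x \<in> W \<Longrightarrow> E x \<in> W"
    and E: "lin E" "\<And>j x. X j (E x) = E (X j x)" "\<And>j x. Y j (E x) = E (Y j x)"
      "\<And>m x. x \<in> G m \<Longrightarrow> E x \<in> G (m + 2)"
    and v: "v \<in> W" "v \<in> G r" "\<And>c. (\<Sum>i<L. c i *s (E ^^ i) v) \<in> N \<Longrightarrow> \<forall>i<L. c i = 0"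
    and B: "finite B0" "finite B1" "B0 \<subseteq> B1" "B0 \<subseteq> N" "G (r + 4 * CARD('v) * m + 2 * L) \<inter> W \<subseteq> span B1"
  shows "m ^ (2 * CARD('v)) * L \<le> (card B1 - card B0)\<^sup>2"
proof -
  obtain js where js: "set js = (UNIV :: 'v set)" "distinct js" using finite_distinct_list[OF finite] by blast
  define PQs where "PQs = xd_pairs X Y js"
  have len: "length PQs = 2 * CARD('v)"
    using js distinct_card[OF js(2)] by (simp add: PQs_def length_xd_pairs)
  have sets: "set (map fst PQs) \<subseteq> fst ` set PQs \<union> snd ` set PQs"
    "set (map snd PQs) \<subseteq> fst ` set PQs \<union> snd ` set PQs" by auto
  have PW: "T w \<in> W" if "T \<in> fst ` set PQs \<union> snd ` set PQs" "w \<in> W" for T w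
    using that W by (auto simp: PQs_def set_xd_pairs)
  have q: "word (map snd PQs) ds v \<in> G (r + 2 * CARD('v) * m) \<inter> W" if "ds \<in> box (length PQs) m" for ds
  proof
    show "word (map snd PQs) ds v \<in> W"
      by (rule word_in[where W = W, OF _ v(1)], rule PW) (use sets(2) in auto)
    have "word (map snd PQs) ds v \<in> G (r + length (map snd PQs) * m)"
      by (rule word_G[OF _ _ v(2)], rule XY_G[of _ js]) (use sets(2) that in \<open>auto simp: PQs_def\<close>)
    then show "word (map snd PQs) ds v \<in> G (r + 2 * CARD('v) * m)" by (simp add: len)
  qed
  have "m ^ length PQs * L \<le> (card B1 - card B0)\<^sup>2"
  proof (rule bernstein_bound[OF _ N(1) _ E(1) N(4) _ v(3) B(1-4)])
    show "weyl_pairs PQs" unfolding PQs_def by (rule weyl_pairs_xd[OF js(2)])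
    show "P x \<in> N \<and> Q x \<in> N" if "(P, Q) \<in> set PQs" "x \<in> N" for P Q x
      using that N by (auto simp: PQs_def set_xd_pairs)
    show "Q (E x) = E (Q x)" if "(P, Q) \<in> set PQs" for P Q x
      using that E(2,3) by (auto simp: PQs_def set_xd_pairs)
    show "word (map snd PQs) ds v \<in> span B1" if "ds \<in> box (length PQs) m" for ds
      using q[OF that] B(5) G_mono[of "r + 2 * CARD('v) * m" "r + 4 * CARD('v) * m + 2 * L"] by auto
    fix as ds i assume as: "as \<in> box (length PQs) m" and ds: "ds \<in> box (length PQs) m" and i: "i < L"
    have Eq: "(E ^^ i) (word (map snd PQs) ds v) \<in> G (r + 2 * CARD('v) * m + 2 * i)"
      by (rule funpow_G[OF E(4)]) (use q[OF ds] in auto)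
    have EW: "(E ^^ i) (word (map snd PQs) ds v) \<in> W"
      by (rule funpow_in[where T = E, OF W(3)]) (use q[OF ds] in auto)
    have "word (map fst PQs) as ((E ^^ i) (word (map snd PQs) ds v)) \<in> W"
      by (rule word_in[where W = W, OF _ EW], rule PW) (use sets(1) in auto)
    moreover have "word (map fst PQs) as ((E ^^ i) (word (map snd PQs) ds v))
      \<in> G (r + 2 * CARD('v) * m + 2 * i + length (map fst PQs) * m)"
      by (rule word_G[OF _ _ Eq], rule XY_G[of _ js]) (use sets(1) as in \<open>auto simp: PQs_def\<close>)
    moreover have "r + 2 * CARD('v) * m + 2 * i + length (map fst PQs) * m \<le> r + 4 * CARD('v) * m + 2 * L"
      using i by (simp add: len)
    ultimately show "word (map fst PQs) as ((E ^^ i) (word (map snd PQs) ds v)) \<in> span B1"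
      using B(5) G_mono by blast
  qed
  then show ?thesis by (simp add: len)
qed

text \<open>A generating field is moved past the operators that build the closure. Past
  \<open>actA f\<close> it leaves a term in \<open>A\<close>; past \<open>Y j\<close> it leaves a
  multiple of another generating field, applied to an element already treated.\<close>

lemma weyl_closure_step:
  assumes "T \<in> gen_ops" "w \<in> weyl_closure (G r)"
  shows "T w \<in> weyl_closure (G (Suc r))"
proof -
  have sub: "weyl_closure (G r) \<subseteq> weyl_closure (G (Suc r))"
    by (rule weyl_closure_minimal) (use G_mono[of r "Suc r"] in \<open>auto intro: weyl_closure.base\<close>)
  have "actV \<eta> w \<in> weyl_closure (G (Suc r))" if "\<eta> \<in> gen_fields" for \<eta>
    using assms(2) that
  proof (induction arbitrary: \<eta> rule: weyl_closure.induct)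
    case zero
    have "actV \<eta> 0 = 0" using lin_0[OF lin_V] zero gen_fields_Der by blast
    then show ?case by (simp add: weyl_closure.zero)
  next
    case (base x)
    show ?case by (rule weyl_closure.base[OF G_op[OF gen_ops_space[OF V_gen[OF base(2)]] base(1)]])
  next
    case (add x y)
    then have "\<eta> \<in> Der" using gen_fields_Der by blast
    then show ?case using add by (simp add: V_add weyl_closure.add)
  next
    case (A x f)
    then have "\<eta> \<in> Der" using gen_fields_Der by blast
    then show ?case
      using A sub by (auto simp: V_A intro!: weyl_closure.add weyl_closure.A)
  next
    case (Y x j)
    from Y(3) obtain \<gamma> i where \<eta>: "\<eta> = Amul_V (mon \<gamma>) (pd i)" and \<gamma>: "\<forall>k. Poly_Mapping.lookup \<gamma> k \<le> 3"
      by (auto simp: gen_fields_def)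
    \<comment> \<open>The bracket of \<open>pd j\<close> with \<eta> is \<open>c\<close> times this
      field. Its exponents are still at most 3, so the induction hypothesis, which holds for all
      generating fields, applies to it.\<close>
    define \<xi> :: "('v, 'k) mpoly \<Rightarrow> ('v, 'k) mpoly" where "\<xi> = Amul_V (mon (\<gamma> - Poly_Mapping.single j 1)) (pd i)"
    define c :: 'k where "c = of_nat (Poly_Mapping.lookup \<gamma> j)"
    have "Poly_Mapping.lookup (\<gamma> - Poly_Mapping.single j 1) k \<le> 3" for k
      using \<gamma>[rule_format, of k] by (simp add: lookup_minus)
    then have \<xi>: "\<xi> \<in> gen_fields" unfolding gen_fields_def \<xi>_def by blast
    have D: "\<eta> \<in> Der" "\<xi> \<in> Der" using Y(3) \<xi> gen_fields_Der by auto
    have "bracket (pd j) \<eta> = (\<lambda>g. const c * \<xi> g)"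
      unfolding \<eta> bracket_pd_mon \<xi>_def c_def by (simp add: Amul_V_def mult.assoc)
    then have "c *s actV \<xi> x = Y j (actV \<eta> x) - actV \<eta> (Y j x)"
      using V_bracket[OF pd_Der D(1), of j x] V_cmult[OF D(2), of c x] by simp
    then have "actV \<eta> (Y j x) = Y j (actV \<eta> x) - c *s actV \<xi> x" by (simp add: algebra_simps)
    moreover have "Y j (actV \<eta> x) \<in> weyl_closure (G (Suc r))"
      by (rule weyl_closure.Y[OF Y(2)[OF Y(3)]])
    ultimately show ?case
      using Y(2)[OF \<xi>] subspace_diff[OF subspace_weyl_closure] subspace_scale[OF subspace_weyl_closure]
      by metis
  qed
  moreover have "X j w \<in> weyl_closure (G (Suc r))" for j
    using sub assms(2) by (auto intro: weyl_closure.A)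
  ultimately show ?thesis using assms sub by (auto simp: gen_ops_def)
qed

definition polynomial_growth :: bool where
  "polynomial_growth \<longleftrightarrow> limsup (\<lambda>m. ereal (ln (real (vdim actA (G m))) / ln (real m))) \<le> ereal (real CARD('v))"

text \<open>Otherwise the submodules generated by \<open>G 0\<close>, \<open>G 1\<close>, ... grow
  strictly at each step. By the Bernstein bound each of the first \<open>m\<close> steps adds at
  least \<open>m^n\<close> dimensions to one fixed piece of the filtration, too many for the assumed
  growth.\<close>

lemma weyl_finitely_generated:
  assumes "polynomial_growth"
  shows "\<exists>r. weyl_closure (G r) = UNIV"
proof (rule ccontr)
  assume neg: "\<nexists>r. weyl_closure (G r) = UNIV"
  define N where "N r = weyl_closure (G r)" for r
  have N_sub: "subspace (N r)" for r by (simp add: N_def subspace_weyl_closure)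
  have GN: "G r \<subseteq> N r" for r by (auto simp: N_def intro: weyl_closure.base)
  \<comment> \<open>If \<open>G (Suc r)\<close> lay in \<open>N r\<close>, the generators would map
    \<open>N r\<close> into \<open>N (Suc r)\<close>, hence into itself, and \<open>N r\<close>
    would be everything.\<close>
  have "\<not> G (Suc r) \<subseteq> N r" for r
  proof
    assume "G (Suc r) \<subseteq> N r"
    then have sub: "N (Suc r) \<subseteq> N r" unfolding N_def by (rule weyl_closure_minimal)
    have "N r = UNIV"
    proof (rule invariant_UNIV[OF N_sub])
      show "M0 \<subseteq> N r" using M0_G G_mono[of 0 r] GN by blast
      show "T x \<in> N r" if "T \<in> gen_ops" "x \<in> N r" for T x
        using weyl_closure_step[OF that(1)] that(2) sub by (auto simp: N_def)
    qed
    then show False using neg by (auto simp: N_def)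
  qed
  then have "\<forall>r. \<exists>v. v \<in> G (Suc r) \<and> v \<notin> N r" by blast
  then obtain u where u: "\<And>r. u r \<in> G (Suc r)" "\<And>r. u r \<notin> N r" by metis
  have "m ^ (2 * CARD('v) + 1) \<le> (vdim actA (G ((4 * CARD('v) + 3) * m)))\<^sup>2" if m: "m \<ge> 1" for m
  proof -
    \<comment> \<open>The constant covers the degree \<open>Suc r + 4nm + 2\<close> of the Bernstein
      bound for every step, since \<open>Suc r\<close> is at most \<open>m\<close> and
      \<open>2\<close> at most \<open>2m\<close>.\<close>
    define Gt where "Gt = G ((4 * CARD('v) + 3) * m)"
    have "\<exists>B. independent B \<and> B \<subseteq> Gt \<inter> N r \<and> Gt \<inter> N r \<subseteq> span B \<and> r * m ^ CARD('v) \<le> card B" if "r \<le> m" for r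
      using that
    proof (induction r)
      case 0
      obtain B where "B \<subseteq> Gt \<inter> N 0" "independent B" "Gt \<inter> N 0 \<subseteq> span B"
        by (rule maximal_independent_subset)
      then show ?case by auto
    next
      case (Suc r)
      then obtain B0 where B0: "independent B0" "B0 \<subseteq> Gt \<inter> N r" "Gt \<inter> N r \<subseteq> span B0" "r * m ^ CARD('v) \<le> card B0"
        by auto
      have NS: "N r \<subseteq> N (Suc r)" unfolding N_def
        by (rule weyl_closure_minimal) (use G_mono[of r "Suc r"] in \<open>auto intro: weyl_closure.base\<close>)
      then have "B0 \<subseteq> Gt \<inter> N (Suc r)" using B0(2) by blast
      then obtain B1 where B1: "B0 \<subseteq> B1" "B1 \<subseteq> Gt \<inter> N (Suc r)" "independent B1" "Gt \<inter> N (Suc r) \<subseteq> span B1"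
        using maximal_independent_subset_extend[OF _ B0(1)] by metis
      have fin: "finite B0" "finite B1"
        using vdim_G_ge[OF B0(1)] vdim_G_ge[OF B1(3)] B0(2) B1(2) by (auto simp: Gt_def)
      have "Suc r + 4 * CARD('v) * m + 2 * 1 \<le> (4 * CARD('v) + 3) * m"
        using Suc.prems m by (simp add: algebra_simps)
      then have sub: "G (Suc r + 4 * CARD('v) * m + 2 * 1) \<inter> N (Suc r) \<subseteq> span B1"
        using G_mono B1(4) unfolding Gt_def by blast
      have "m ^ (2 * CARD('v)) * 1 \<le> (card B1 - card B0)\<^sup>2"
      \<comment> \<open>No extra operator is needed here: with \<open>E\<close> the identity and
        \<open>L = 1\<close>, the independence condition says that \<open>u r\<close> is not in
        \<open>N r\<close>.\<close>
      proof (rule bernstein_G[where E = "\<lambda>x. x" and N = "N r" and v = "u r", OF N_sub _ _ _ _ _ _ _ _ _ _ _ u(1) _ fin B1(1) _ sub])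
        show "\<forall>i<1. c i = 0" if "(\<Sum>i<1. c i *s ((\<lambda>x. x) ^^ i) (u r)) \<in> N r" for c
        proof -
          have c: "c 0 *s u r \<in> N r" using that by simp
          have "c 0 = 0"
          proof (rule ccontr)
            assume "c 0 \<noteq> 0"
            then have "u r = inverse (c 0) *s (c 0 *s u r)" by simp
            then have "u r \<in> N r" using subspace_scale[OF N_sub c] by metis
            then show False using u(2) by blast
          qed
          then show ?thesis by simp
        qed
        show "u r \<in> N (Suc r)" using u(1) GN by blast
        show "x \<in> G (m + 2)" if "x \<in> G m" for m x using that G_mono[of m "m + 2"] by auto
        show "B0 \<subseteq> N r" using B0(2) by blast
      qed (auto simp: N_def lin_def intro: weyl_closure.A weyl_closure.Y)
      then have "(m ^ CARD('v))\<^sup>2 \<le> (card B1 - card B0)\<^sup>2" by (simp add: power_mult mult.commute flip: power_mult)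
      then have "m ^ CARD('v) \<le> card B1 - card B0" by (simp only: power2_nat_le_eq_le)
      then have "Suc r * m ^ CARD('v) \<le> card B1" using B0(4) card_mono[OF fin(2) B1(1)] by simp
      then show ?case using B1 by blast
    qed
    from this[of m] obtain B where B: "independent B" "B \<subseteq> Gt" "m * m ^ CARD('v) \<le> card B" by auto
    have "m ^ (2 * CARD('v) + 1) \<le> (m * m ^ CARD('v))\<^sup>2"
      using m by (simp add: power_mult_distrib power2_eq_square power_add mult_2)
    also have "\<dots> \<le> (vdim actA Gt)\<^sup>2"
      using B(3) vdim_G_ge[OF B(1) B(2)[unfolded Gt_def]]
      by (intro power_mono) (auto simp: Gt_def)
    finally show ?thesis by (simp add: Gt_def)
  qed
  from growth_contradiction[OF assms[unfolded polynomial_growth_def] _ this] show False by simp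
qed

section \<open>Algebraicity of \<open>t_1\<close>\<close>

lemma t_1: "t j 1 x = actV (Amul_V (var j) (pd j)) x - X j (Y j x)"
  by (simp add: J_Suc J_0)

lemma t_1_G: "x \<in> G m \<Longrightarrow> t j 1 x \<in> G (m + 2)"
proof -
  assume x: "x \<in> G m"
  have "actV (Amul_V (var j) (pd j)) x \<in> G (Suc m)"
    by (rule G_op[OF gen_ops_space[OF V_gen[OF euler_gen]] x])
  then have "actV (Amul_V (var j) (pd j)) x \<in> G (m + 2)" using G_mono[of "Suc m" "m + 2"] by auto
  moreover have "X j (Y j x) \<in> G (Suc (Suc m))"
    by (intro G_op[OF gen_ops_space] X_gen V_gen pd_gen x)
  ultimately show ?thesis unfolding t_1 by (intro subspace_diff[OF subspace_G]) auto
qed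

text \<open>Without a relation all powers of \<open>t_1\<close> applied to \<open>v\<close> are
  independent. As \<open>t_1\<close> commutes with the Weyl algebra, the Bernstein bound applies
  with \<open>N = {0}\<close> and \<open>L = m\<close>, and the extra factor \<open>m\<close>
  contradicts the growth.\<close>

lemma t_1_algebraic:
  assumes "polynomial_growth"
  shows "\<exists>L c. (\<exists>i<L. c i \<noteq> 0) \<and> (\<Sum>i<L. c i *s (t j 1 ^^ i) v) = 0"
proof (rule ccontr)
  assume neg: "\<not> ?thesis"
  obtain r where r: "v \<in> G r" using G_exhausts by blast
  have "m ^ (2 * CARD('v) + 1) \<le> (vdim actA (G ((r + 4 * CARD('v) + 2) * m)))\<^sup>2" if m: "m \<ge> 1" for m
  proof -
    define Gt where "Gt = G ((r + 4 * CARD('v) + 2) * m)"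
    obtain B where B: "B \<subseteq> Gt" "independent B" "Gt \<subseteq> span B" by (rule maximal_independent_subset)
    have fin: "finite B" "card B \<le> vdim actA Gt" using vdim_G_ge[OF B(2)] B(1) by (auto simp: Gt_def)
    have "r + 4 * CARD('v) * m + 2 * m \<le> (r + 4 * CARD('v) + 2) * m" using m by (simp add: algebra_simps)
    then have sub: "G (r + 4 * CARD('v) * m + 2 * m) \<inter> UNIV \<subseteq> span B"
      using G_mono B(3) unfolding Gt_def by blast
    have "m ^ (2 * CARD('v)) * m \<le> (card B - card ({} :: 'm set))\<^sup>2"
    proof (rule bernstein_G[where E = "t j 1" and N = "{0}" and v = v, OF _ _ _ _ _ _ _ _ _ _ t_1_G _ r _ _ fin(1) _ _ sub])
      show "lin (t j 1)" by (rule lin_J[OF pd_Der])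
      show "X i (t j 1 x) = t j 1 (X i x)" for i x using J_A[OF pd_Der, of "var j" 0] by simp
      show "Y i (t j 1 x) = t j 1 (Y i x)" for i x by (rule t_pd)
      show "\<forall>i<m. c i = 0" if "(\<Sum>i<m. c i *s (t j 1 ^^ i) v) \<in> {0}" for c
        using that neg by blast
      show "t j 1 x \<in> {0}" if "x \<in> {0}" for x using that lin_0[OF lin_J[OF pd_Der]] by simp
      show "Y i x \<in> {0}" if "x \<in> {0}" for x i using that lin_0[OF lin_V[OF pd_Der]] by simp
    qed (auto simp: A_zero subspace_def)
    also have "\<dots> \<le> (vdim actA Gt)\<^sup>2" using fin(2) by (intro power_mono) auto
    finally show ?thesis by (simp add: Gt_def mult.commute)
  qed
  from growth_contradiction[OF assms[unfolded polynomial_growth_def] _ this] show False by simp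
qed

end

section \<open>Vanishing of the higher differences\<close>

context char0_space
begin

lemma linear_factor_action:
  assumes "lin E" "coeff q L = 0"
  shows "(\<Sum>i<Suc L. coeff ([:- l, 1:] * q) i *s (E ^^ i) v)
    = (\<Sum>i<L. coeff q i *s (E ^^ i) (E v - l *s v))"
proof -
  have lE: "lin (E ^^ i)" for i by (rule lin_funpow[OF assms(1)])
  have "(\<Sum>i<Suc L. coeff ([:- l, 1:] * q) i *s (E ^^ i) v)
    = (\<Sum>i<Suc L. coeff (pCons 0 q) i *s (E ^^ i) v) - (\<Sum>i<Suc L. (l * coeff q i) *s (E ^^ i) v)"
    unfolding sum_subtractf[symmetric] by (intro sum.cong) (simp_all add: scale_left_diff_distrib)
  also have "(\<Sum>i<Suc L. coeff (pCons 0 q) i *s (E ^^ i) v) = (\<Sum>i<L. coeff q i *s (E ^^ i) (E v))"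
    unfolding sum.lessThan_Suc_shift by (simp add: funpow_swap1)
  also have "(\<Sum>i<Suc L. (l * coeff q i) *s (E ^^ i) v) = (\<Sum>i<L. coeff q i *s (E ^^ i) (l *s v))"
    using assms(2) by (simp add: lin_scale[OF lE] mult.commute)
  finally show ?thesis
    by (simp add: lin_diff[OF lE] scale_right_diff_distrib sum_subtractf)
qed

text \<open>The product of the operators \<open>E - l\<close> over the list, with repetitions
  allowed; it plays the role of a split annihilating polynomial.\<close>

primrec shifts :: "('b \<Rightarrow> 'b) \<Rightarrow> 'k list \<Rightarrow> 'b \<Rightarrow> 'b" where
  "shifts E [] v = v"
| "shifts E (l # ls) v = shifts E ls (E v - l *s v)"

lemma shifts_append: "shifts E (ls @ ms) v = shifts E ms (shifts E ls v)"
  by (induction ls arbitrary: v) auto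

lemma lin_shifts:
  assumes "lin E"
  shows "lin (shifts E ls)"
proof (induction ls)
  case (Cons l ls)
  have "lin (\<lambda>v. E v - l *s v)" using assms by (simp add: lin_def algebra_simps)
  from lin_comp[OF Cons this] show ?case by (simp add: lin_def)
qed (simp add: lin_def)

lemma shifts_commute_op:
  assumes "lin T" "\<And>v. E (T v) = T (E v)"
  shows "shifts E ls (T v) = T (shifts E ls v)"
proof (induction ls arbitrary: v)
  case (Cons l ls)
  have "E (T v) - l *s T v = T (E v - l *s v)"
    by (simp add: assms(2) lin_diff[OF assms(1)] lin_scale[OF assms(1)])
  then show ?case by (simp add: Cons)
qed simp

lemma shifts_commute:
  assumes "lin E"
  shows "shifts E ls (shifts E ms v) = shifts E ms (shifts E ls v)"
proof (rule shifts_commute_op[OF lin_shifts[OF assms]])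
  show "E (shifts E ms v) = shifts E ms (E v)" for v
    using shifts_commute_op[of E E ms v] assms by simp
qed

lemma shifts_0: "lin E \<Longrightarrow> shifts E ls 0 = 0"
  by (rule lin_0[OF lin_shifts])

text \<open>On an eigenvector for \<nu> the product acts as the scalar product of the
  \<open>\<nu> - m\<close>, which is nonzero.\<close>

lemma shifts_eigenvector:
  assumes "lin E"
  shows "E w = \<nu> *s w \<Longrightarrow> \<nu> \<notin> set ms \<Longrightarrow> shifts E ms w = 0 \<Longrightarrow> w = 0"
proof (induction ms arbitrary: w)
  case (Cons m ms)
  have "E ((\<nu> - m) *s w) = \<nu> *s ((\<nu> - m) *s w)"
    using Cons.prems(1) by (simp add: lin_scale[OF assms] mult.commute)
  moreover have "shifts E ms ((\<nu> - m) *s w) = 0"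
    using Cons.prems(1,3) by (simp add: scale_left_diff_distrib)
  ultimately have "(\<nu> - m) *s w = 0" using Cons.IH[of "(\<nu> - m) *s w"] Cons.prems(2) by fastforce
  then show ?case using Cons.prems(2) by simp
qed simp

text \<open>Induction on \<open>ls\<close>: once \<theta> kills \<open>E v - l *s v\<close>, the
  vector \<open>\<theta> v\<close> satisfies the eigenvector equation for \<open>l + d\<close>.
  Since \<open>l + d\<close> is not among the roots \<open>ms\<close> that annihilate everything, it
  must be zero.\<close>

lemma eigen_operator_vanishes:
  assumes E: "lin E" and \<theta>: "lin \<theta>" "\<And>x. E (\<theta> x) = \<theta> (E x) + d *s \<theta> x"
    and ms: "\<And>x. shifts E ms x = 0"
    and d: "\<And>l m. l \<in> set ls \<Longrightarrow> m \<in> set ms \<Longrightarrow> l + d \<noteq> m"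
    and v: "shifts E ls v = 0"
  shows "\<theta> v = 0"
  using d v
proof (induction ls arbitrary: v)
  case Nil
  then show ?case by (simp add: lin_0[OF \<theta>(1)])
next
  case (Cons l ls)
  then have "\<theta> (E v - l *s v) = 0" by simp
  then have "E (\<theta> v) = (l + d) *s \<theta> v"
    by (simp add: \<theta>(2) lin_diff[OF \<theta>(1)] lin_scale[OF \<theta>(1)] scale_left_distrib)
  moreover have "l + d \<notin> set ms" using Cons.prems(1) by auto
  ultimately show ?case using shifts_eigenvector[OF E] ms by blast
qed

text \<open>Algebraic closedness splits off one linear factor at a time;
  \<open>linear_factor_action\<close> passes it on to the vector.\<close>

lemma poly_annihilated_by_shifts:
  assumes "alg_closed TYPE('k)" "lin E" "p \<noteq> 0" "degree p < L"
    "(\<Sum>i<L. coeff p i *s (E ^^ i) v) = 0"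
  shows "\<exists>ls. shifts E ls v = 0"
  using assms(3-)
proof (induction "degree p" arbitrary: p L v)
  case 0
  then obtain c where c: "p = [:c:]" "c \<noteq> 0" by (metis degree_eq_zeroE pCons_0_0)
  obtain L' where L: "L = Suc L'" using 0 by (cases L) auto
  have "c *s v = 0" using 0(4) unfolding L sum.lessThan_Suc_shift c by simp
  then show ?case using c(2) by (intro exI[of _ "[]"]) simp
next
  case (Suc k)
  have "degree p > 0" by (simp flip: Suc.hyps(2))
  then obtain l where "poly p l = 0" using assms(1) by (auto simp: alg_closed_def)
  then obtain q where q: "p = [:- l, 1:] * q" by (auto simp: poly_eq_0_iff_dvd elim: dvdE)
  have q0: "q \<noteq> 0" using Suc.prems(1) q by auto
  have "degree p = Suc (degree q)" unfolding q using q0 by (subst degree_mult_eq) auto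
  then have k: "k = degree q" using Suc.hyps(2) by simp
  obtain L' where L: "L = Suc L'" using Suc.prems(2) by (cases L) auto
  have L': "degree q < L'" using Suc.prems(2) Suc.hyps(2) L k by simp
  have "(\<Sum>i<L'. coeff q i *s (E ^^ i) (E v - l *s v)) = 0"
    using Suc.prems(3) linear_factor_action[OF assms(2), of q L' l v] L' unfolding L q
    by (simp add: coeff_eq_0)
  from Suc.hyps(1)[OF k q0 L' this] obtain ls where "shifts E ls (E v - l *s v) = 0" by blast
  then show ?case by (intro exI[of _ "l # ls"]) simp
qed

lemma annihilated_by_shifts:
  assumes "alg_closed TYPE('k)" "lin E" "i < L" "c i \<noteq> 0" "(\<Sum>i<L. c i *s (E ^^ i) v) = 0"
  shows "\<exists>ls. shifts E ls v = 0"
proof -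
  define p where "p = Poly (map c [0..<L])"
  have coeff: "coeff p k = (if k < L then c k else 0)" for k
    by (simp add: p_def coeff_Poly_eq nth_default_def)
  have "p \<noteq> 0" using coeff[of i] assms(3,4) by auto
  moreover have "degree p < L"
  proof (rule ccontr)
    assume "\<not> degree p < L"
    then have "coeff p (degree p) = 0" by (simp add: coeff)
    with \<open>p \<noteq> 0\<close> show False by simp
  qed
  moreover have "(\<Sum>i<L. coeff p i *s (E ^^ i) v) = 0" using assms(5) by (simp add: coeff)
  ultimately show ?thesis by (rule poly_annihilated_by_shifts[OF assms(1,2)])
qed

end

section \<open>Vanishing of \<open>t_a\<close> by shifting eigenvalues\<close>

context AV_generated
begin

text \<open>One product of linear factors in \<open>t_1\<close> annihilates the finitely many
  generators over the Weyl algebra, hence everything, because \<open>t_1\<close> commutes with that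
  algebra. So \<open>t_1\<close> has only finitely many possible eigenvalues, and a large shift
  leaves this finite set.\<close>

lemma t_eventually_zero:
  assumes ac: "alg_closed TYPE('k)" and gr: "polynomial_growth"
  shows "\<exists>N. \<forall>a\<ge>N. \<forall>x. t j a x = 0"
proof -
  define E where "E = t j 1"
  have E: "lin E" unfolding E_def by (rule lin_J[OF pd_Der])
  obtain r where r: "weyl_closure (G r) = UNIV" using weyl_finitely_generated[OF gr] by blast
  obtain B where B: "finite B" "G r \<subseteq> span B" using G_fd by blast
  from B(1) have "\<exists>ls. \<forall>b\<in>B. shifts E ls b = 0"
  proof (induction B rule: finite_induct)
    case (insert b B)
    then obtain ls where ls: "\<forall>b\<in>B. shifts E ls b = 0" by blast
    obtain ms where ms: "shifts E ms b = 0"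
      using t_1_algebraic[OF gr, of j b, folded E_def] annihilated_by_shifts[OF ac E] by metis
    \<comment> \<open>The factors commute, so the concatenated list kills whatever either list
      kills.\<close>
    have "shifts E (ls @ ms) x = 0" if "x \<in> insert b B" for x
      using that ls ms shifts_commute[OF E, of ms ls b] by (auto simp: shifts_append shifts_0[OF E])
    then show ?case by blast
  qed simp
  then obtain ls where ls: "\<forall>b\<in>B. shifts E ls b = 0" by blast
  have all: "shifts E ls x = 0" for x
  proof -
    have "x \<in> weyl_closure (G r)" by (simp add: r)
    then show ?thesis
    proof (induction rule: weyl_closure.induct)
      case (base x)
      have "shifts E ls x \<in> {0}"
        by (rule lin_span[OF lin_shifts[OF E], where S = B]) (use base B ls in \<open>auto simp: subspace_def\<close>)
      then show ?case by simp
    next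
      case (add x y)
      then show ?case by (simp add: lin_add[OF lin_shifts[OF E]])
    next
      case (A x f)
      have "E (actA f y) = actA f (E y)" for y using J_A[OF pd_Der, of "var j" 0] by (simp add: E_def)
      then show ?case using shifts_commute_op[OF lin_A, of E f ls x] A by (simp add: A_zero)
    next
      case (Y x i)
      have "E (actV (pd i) y) = actV (pd i) (E y)" for y by (simp add: E_def t_pd)
      then show ?case using shifts_commute_op[OF lin_V[OF pd_Der], of E i ls x] Y
        by (simp add: lin_0[OF lin_V[OF pd_Der]])
    qed (rule shifts_0[OF E])
  qed
  \<comment> \<open>The shifts that can carry one root to another. There are finitely many, as
    \<open>of_nat\<close> is injective in characteristic zero.\<close>
  define Bad where "Bad = (\<Union>l\<in>set ls. \<Union>m\<in>set ls. (of_nat :: nat \<Rightarrow> 'k) -` {m - l})"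
  have "finite Bad" unfolding Bad_def by (intro finite_UN_I finite_set finite_vimageI) (auto simp: inj_def)
  then obtain N where N: "\<And>b. b \<in> Bad \<Longrightarrow> b < N" using finite_nat_set_iff_bounded by metis
  have "t j a x = 0" if a: "a \<ge> Suc N" for a x
  proof -
    obtain b where b: "a = Suc b" "b \<ge> N" using a by (cases a) auto
    have "b \<notin> Bad" using N b(2) by (meson not_less)
    then have d: "l + of_nat b \<noteq> m" if "l \<in> set ls" "m \<in> set ls" for l m
      using that by (force simp: Bad_def)
    have w: "E (t j (Suc b) y) = t j (Suc b) (E y) + of_nat b *s t j (Suc b) y" for y
      unfolding E_def by (rule t_weight)
    show ?thesis unfolding b(1)
      by (rule eigen_operator_vanishes[OF E lin_J[OF pd_Der] w all d all])
  qed
  then show ?thesis by blast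
qed

end

section \<open>Differentiability of holonomic modules\<close>

context AV
begin

lemma holonomic_t_eventually_zero:
  assumes "alg_closed TYPE('k)" "holonomic actA actV"
  shows "\<exists>N. \<forall>a\<ge>N. \<forall>x. t j a x = 0"
proof (cases "(UNIV :: 'm set) = {0}")
  case True
  then have "t j a x = 0" for a x by (metis UNIV_I singletonD)
  then show ?thesis by blast
next
  case False
  then have GK: "GKdim actA actV = ereal (real CARD('v))" using assms(2) by (simp add: holonomic_def)
  obtain M0 where M0: "gen_mod_subspace actA actV M0"
    using assms(2) by (auto simp: holonomic_def fin_gen_def)
  interpret AV_generated actA actV M0 by unfold_locales (rule M0)
  \<comment> \<open>The dimension is a supremum over all generating pairs, so it bounds the growth
    for this particular one.\<close>
  have "(gen_space, M0) \<in> {(C, M0). gen_alg_subspace actA actV C \<and> gen_mod_subspace actA actV M0}"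
    using M0 gen_space_generates by simp
  then have "limsup (\<lambda>m. ereal (ln (real (vdim actA (powmod actA (fst (gen_space, M0)) m (snd (gen_space, M0))))) / ln (real m)))
      \<le> GKdim actA actV"
    unfolding GKdim_def by (rule SUP_upper)
  then have "polynomial_growth"
    by (simp add: polynomial_growth_def G_def GK)
  from t_eventually_zero[OF assms(1) this] show ?thesis .
qed

text \<open>For each variable the vanishing of the \<open>t_a\<close> from \<open>N j\<close> on
  makes the difference of order \<open>N j + 2\<close> zero on all of \<open>Der\<close>; the sum of
  these orders serves as \<open>s\<close>.\<close>

lemma holonomic_differentiable:
  assumes "alg_closed TYPE('k)" "holonomic actA actV"
  shows "\<exists>s. actV \<in> Diff actA s"
proof -
  obtain N where N: "\<And>j a x. a \<ge> N j \<Longrightarrow> t j a x = 0"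
    using holonomic_t_eventually_zero[OF assms] by metis
  have "(delta actA (var j) ^^ (N j + 2)) actV \<eta> x = 0" if "\<eta> \<in> Der" for j \<eta> x
  proof -
    have "J (var j) (N j + 2) \<eta> x = 0" by (rule J_vanish[where N = "N j", OF that]) (simp_all add: N)
    then show ?thesis by (simp only: J_def)
  qed
  from Diff_if_delta_nilpotent[OF Hom_V this] show ?thesis by blast
qed

end

theorem theorem4p4:
  fixes actA :: "('v::finite, 'k::field_char_0) mpoly \<Rightarrow> 'm::ab_group_add \<Rightarrow> 'm"
    and actV :: "(('v, 'k) mpoly \<Rightarrow> ('v, 'k) mpoly) \<Rightarrow> 'm \<Rightarrow> 'm"
  assumes "alg_closed TYPE('k)"
    and "uncountable (UNIV :: 'k set)"
    and "AV_module actA actV"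
    and "holonomic actA actV"
  shows "\<exists>s. actV \<in> Diff actA s"
proof -
  interpret AV actA actV by unfold_locales (rule assms(3))
  show ?thesis by (rule holonomic_differentiable[OF assms(1,4)])
qed

end
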